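(* Let $\mathcal{A}=C([0,1])$ be the $C^*$-algebra of continuous $\mathbb{C}$-valued functions on $[0,1]$. Let $f\in\mathcal{A}$ be given by $f(x)=x$ for all $x\in[0,1]$, and let $g\in\mathcal{A}$ be given by $g(x)=\frac{1}{\log(2/x)}$ for $x\in(0,1]$ and $g(0)=0$. Then there is a regular Sylvester matrix rank function $\mathrm{rk}\in\mathbb{P}_{\mathrm{reg}}(\mathcal{A})$ such that $\mathrm{rk}(g)=1$ and $\mathrm{rk}(f)=0$. In particular, $\mathrm{rk}$ is not a dimension function for $\mathcal{A}$.
   Context: $M(R)$ is the set of all rectangular matrices over a unital (nonzero) ring $R$; $\mathrm{diag}(A,B)$ is the block diagonal matrix. A Sylvester matrix rank function for $R$ is a function $\mathrm{rk}:M(R)\to\mathbb{R}_{\ge0}$ such that (i) $\mathrm{rk}(0)=0$ (for every zero matrix) and $\mathrm{rk}(1)=1$; (ii) $\mathrm{rk}(AB)\le\min(\mathrm{rk}(A),\mathrm{rk}(B))$ whenever $AB$ is defined; (iii) $\mathrm{rk}(\mathrm{diag}(A,B))=\mathrm{rk}(A)+\mathrm{rk}(B)$; (iv) $\mathrm{rk}\left(\begin{bmatrix}A&C\\0&B\end{bmatrix}\right)\ge\mathrm{rk}(A)+\mathrm{rk}(B)$. It is regular if there are a unital ring homomorphism $\varphi:R\to S$ to some von Neumann regular ring $S$ (for every $s\in S$ there is $t\in S$ with $sts=s$) and a Sylvester matrix rank function $\mathrm{rk}_S$ for $S$ with $\mathrm{rk}(A)=\mathrm{rk}_S(\varphi(A))$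 for all $A\in M(R)$. $\mathbb{P}_{\mathrm{reg}}(R)$ is the set of regular Sylvester matrix rank functions for $R$. For a unital $C^*$-algebra $\mathcal{A}$ and $A,B\in M(\mathcal{A})$, $A\preceq_{\mathrm{C}}B$ means there are sequences $\{C_n\},\{D_n\}$ in $M(\mathcal{A})$ with $C_nBD_n\to A$ in norm. A dimension function for $\mathcal{A}$ is a function $\varphi:M(\mathcal{A})\to\mathbb{R}_{\ge0}$ such that $\varphi(A)\le\varphi(B)$ whenever $A\preceq_{\mathrm{C}}B$, $\varphi(1)=1$, and $\varphi(\mathrm{diag}(A,B))=\varphi(A)+\varphi(B)$. *)

theory Defs
  imports
    "HOL-Real_Asymp.Real_Asymp"
    "HOL-Analysis.Uniform_Limit"
    "Jordan_Normal_Form.Matrix"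
    "HOL-Algebra.UnivPoly"
begin

section \<open>Rectangular matrices over a ring with explicit carrier\<close>

text \<open>
  Matrices are those of the type \<^typ>\<open>'a mat\<close>; the ring structure on the entries comes from a
  record, so that the target of a homomorphism can be quantified over inside a formula. Both
  dimensions of a rectangular matrix are at least one.
\<close>

definition mats :: "('a, 'm) ring_scheme \<Rightarrow> 'a mat set" where
  "mats R = {A. 0 < dim_row A \<and> 0 < dim_col A \<and> elements_mat A \<subseteq> carrier R}"

definition zero_matrix :: "('a, 'm) ring_scheme \<Rightarrow> nat \<Rightarrow> nat \<Rightarrow> 'a mat" where
  "zero_matrix R m n = mat m n (\<lambda>_. \<zero>\<^bsub>R\<^esub>)"

definition matrix_of_elem :: "'a \<Rightarrow> 'a mat" where
  "matrix_of_elem a = mat 1 1 (\<lambda>_. a)"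

definition mat_prod :: "('a, 'm) ring_scheme \<Rightarrow> 'a mat \<Rightarrow> 'a mat \<Rightarrow> 'a mat" where
  "mat_prod R A B = mat (dim_row A) (dim_col B)
     (\<lambda>(i, j). \<Oplus>\<^bsub>R\<^esub>k\<in>{..<dim_col A}. A $$ (i, k) \<otimes>\<^bsub>R\<^esub> B $$ (k, j))"

definition mat_diff :: "('a, 'm) ring_scheme \<Rightarrow> 'a mat \<Rightarrow> 'a mat \<Rightarrow> 'a mat" where
  "mat_diff R A B = mat (dim_row A) (dim_col A) (\<lambda>(i, j). A $$ (i, j) \<ominus>\<^bsub>R\<^esub> B $$ (i, j))"

definition upper_block :: "('a, 'm) ring_scheme \<Rightarrow> 'a mat \<Rightarrow> 'a mat \<Rightarrow> 'a mat \<Rightarrow> 'a mat" where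
  "upper_block R A C B = four_block_mat A C (zero_matrix R (dim_row B) (dim_col A)) B"

definition block_diag :: "('a, 'm) ring_scheme \<Rightarrow> 'a mat \<Rightarrow> 'a mat \<Rightarrow> 'a mat" where
  "block_diag R A B = upper_block R A (zero_matrix R (dim_row A) (dim_col B)) B"

section \<open>Sylvester matrix rank functions\<close>

locale sylvester_rank_function = ring R for R (structure) +
  fixes rk :: "'a mat \<Rightarrow> real"
  assumes nonzero_ring: "\<one> \<noteq> \<zero>"
    and rk_nonneg: "A \<in> mats R \<Longrightarrow> 0 \<le> rk A"
    and rk_zero: "\<lbrakk>0 < m; 0 < n\<rbrakk> \<Longrightarrow> rk (zero_matrix R m n) = 0"
    and rk_one: "rk (matrix_of_elem \<one>) = 1"
    and rk_prod: "\<lbrakk>A \<in> mats R; B \<in> mats R; dim_col A = dim_row B\<rbrakk>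
      \<Longrightarrow> rk (mat_prod R A B) \<le> min (rk A) (rk B)"
    and rk_diag: "\<lbrakk>A \<in> mats R; B \<in> mats R\<rbrakk> \<Longrightarrow> rk (block_diag R A B) = rk A + rk B"
    and rk_block: "\<lbrakk>A \<in> mats R; B \<in> mats R; C \<in> mats R; dim_row C = dim_row A; dim_col C = dim_col B\<rbrakk>
      \<Longrightarrow> rk (upper_block R A C B) \<ge> rk A + rk B"

locale von_neumann_regular_ring = ring S for S (structure) +
  assumes nonzero_ring: "\<one> \<noteq> \<zero>"
    and regular: "s \<in> carrier S \<Longrightarrow> \<exists>t\<in>carrier S. s \<otimes> t \<otimes> s = s"

text \<open>
  A formula cannot quantify over all types, so the regular ring \<open>S\<close> is taken with carrier in the
  type \<^typ>\<open>'a list\<close>. The theorem \<open>regular_rank_functionI\<close> below shows that this loses nothing: a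
  regular ring over any type whatsoever can be replaced by one over \<^typ>\<open>'a list\<close>.
\<close>

definition regular_rank_functions :: "('a, 'm) ring_scheme \<Rightarrow> ('a mat \<Rightarrow> real) set" where
  "regular_rank_functions R = {rk. sylvester_rank_function R rk \<and>
     (\<exists>(S :: 'a list ring) \<phi> rk\<^sub>S. von_neumann_regular_ring S \<and> \<phi> \<in> ring_hom R S \<and>
        sylvester_rank_function S rk\<^sub>S \<and> (\<forall>A\<in>mats R. rk A = rk\<^sub>S (map_mat \<phi> A)))}"

subsection \<open>Independence of the type carrying the regular ring\<close>

lemma mats_entry: "A \<in> mats R \<Longrightarrow> i < dim_row A \<Longrightarrow> j < dim_col A \<Longrightarrow> A $$ (i, j) \<in> carrier R"
  unfolding mats_def using elements_matI[of A "dim_row A" "dim_col A" i j] by auto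

lemma matsI:
  assumes "0 < dim_row A" "0 < dim_col A"
    and "\<And>i j. i < dim_row A \<Longrightarrow> j < dim_col A \<Longrightarrow> A $$ (i, j) \<in> carrier R"
  shows "A \<in> mats R"
  using assms unfolding mats_def by (auto dest!: elements_matD)

lemma map_mat_mats:
  assumes "\<phi> \<in> ring_hom R S" "A \<in> mats R"
  shows "map_mat \<phi> A \<in> mats S"
  using assms by (intro matsI) (auto simp: mats_def intro!: ring_hom_closed[OF assms(1)] mats_entry[OF assms(2)])

lemma map_mat_zero_matrix:
  assumes "\<phi> \<in> ring_hom R S" "ring R" "ring S"
  shows "map_mat \<phi> (zero_matrix R m n) = zero_matrix S m n"
  by (rule eq_matI) (auto simp: zero_matrix_def ring_hom_zero[OF assms])

lemma map_mat_upper_block: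
  assumes "\<phi> \<in> ring_hom R S" "ring R" "ring S"
    and "dim_row C = dim_row A" "dim_col C = dim_col B"
  shows "map_mat \<phi> (upper_block R A C B) = upper_block S (map_mat \<phi> A) (map_mat \<phi> C) (map_mat \<phi> B)"
  using assms(4,5)
  by (intro eq_matI) (auto simp: upper_block_def zero_matrix_def ring_hom_zero[OF assms(1-3)])

lemma map_mat_block_diag:
  assumes "\<phi> \<in> ring_hom R S" "ring R" "ring S"
  shows "map_mat \<phi> (block_diag R A B) = block_diag S (map_mat \<phi> A) (map_mat \<phi> B)"
  unfolding block_diag_def
  using map_mat_zero_matrix[OF assms, of "dim_row A" "dim_col B"]
  by (subst map_mat_upper_block[OF assms]) (simp_all add: zero_matrix_def)

lemma map_mat_mat_prod:
  assumes hom: "\<phi> \<in> ring_hom R S" and R: "ring R" and S: "ring S"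
    and A: "A \<in> mats R" and B: "B \<in> mats R" and d: "dim_col A = dim_row B"
  shows "map_mat \<phi> (mat_prod R A B) = mat_prod S (map_mat \<phi> A) (map_mat \<phi> B)"
proof (rule eq_matI)
  interpret R: ring R by fact
  interpret S: ring S by fact
  interpret ring_hom_ring R S \<phi>
    by (rule ring_hom_ringI2[OF R S hom])
  fix i j assume "i < dim_row (mat_prod S (map_mat \<phi> A) (map_mat \<phi> B))"
    "j < dim_col (mat_prod S (map_mat \<phi> A) (map_mat \<phi> B))"
  then have i: "i < dim_row A" and j: "j < dim_col B" by (auto simp: mat_prod_def)
  have a: "A $$ (i, k) \<in> carrier R" if "k < dim_col A" for k using mats_entry[OF A i that] .
  have b: "B $$ (k, j) \<in> carrier R" if "k < dim_col A" for k using mats_entry[OF B _ j] that d by simp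
  have "\<phi> (\<Oplus>\<^bsub>R\<^esub>k\<in>{..<dim_col A}. A $$ (i, k) \<otimes>\<^bsub>R\<^esub> B $$ (k, j))
      = (\<Oplus>\<^bsub>S\<^esub>k\<in>{..<dim_col A}. (\<phi> \<circ> (\<lambda>k. A $$ (i, k) \<otimes>\<^bsub>R\<^esub> B $$ (k, j))) k)"
    using a b by (subst hom_finsum) (auto simp: o_def)
  also have "\<dots> = (\<Oplus>\<^bsub>S\<^esub>k\<in>{..<dim_col A}. \<phi> (A $$ (i, k)) \<otimes>\<^bsub>S\<^esub> \<phi> (B $$ (k, j)))"
    using a b by (intro S.finsum_cong') auto
  also have "\<dots> = (\<Oplus>\<^bsub>S\<^esub>k\<in>{..<dim_col A}. map_mat \<phi> A $$ (i, k) \<otimes>\<^bsub>S\<^esub> map_mat \<phi> B $$ (k, j))"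
    using a b i j d by (intro S.finsum_cong') auto
  finally show "map_mat \<phi> (mat_prod R A B) $$ (i, j) = mat_prod S (map_mat \<phi> A) (map_mat \<phi> B) $$ (i, j)"
    using i j by (simp add: mat_prod_def)
qed (simp_all add: mat_prod_def)

lemma sylvester_rank_function_pullback:
  assumes hom: "\<phi> \<in> ring_hom R S" and R: "ring R" and "sylvester_rank_function S rk"
  shows "sylvester_rank_function R (\<lambda>A. rk (map_mat \<phi> A))"
proof -
  interpret S: sylvester_rank_function S rk by fact
  have S: "ring S" by (rule S.ring_axioms)
  interpret R: ring R by fact
  note [simp] = map_mat_mats[OF hom]
  show ?thesis
  proof
    show "\<one>\<^bsub>R\<^esub> \<noteq> \<zero>\<^bsub>R\<^esub>"
      using ring_hom_zero[OF hom R S] ring_hom_one[OF hom] S.nonzero_ring by metis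
    show "rk (map_mat \<phi> (matrix_of_elem \<one>\<^bsub>R\<^esub>)) = 1"
    proof -
      have "map_mat \<phi> (matrix_of_elem \<one>\<^bsub>R\<^esub>) = matrix_of_elem \<one>\<^bsub>S\<^esub>"
        by (rule eq_matI) (auto simp: matrix_of_elem_def ring_hom_one[OF hom])
      then show ?thesis by (simp add: S.rk_one)
    qed
  next
    fix A B assume "A \<in> mats R" "B \<in> mats R" "dim_col A = dim_row B"
    then show "rk (map_mat \<phi> (mat_prod R A B)) \<le> min (rk (map_mat \<phi> A)) (rk (map_mat \<phi> B))"
      using S.rk_prod[of "map_mat \<phi> A" "map_mat \<phi> B"] by (simp add: map_mat_mat_prod[OF hom R S])
  qed (auto simp: S.rk_nonneg S.rk_zero S.rk_diag S.rk_block
        map_mat_zero_matrix[OF hom R S] map_mat_block_diag[OF hom R S] map_mat_upper_block[OF hom R S])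
qed

text \<open>
  Terms for the elements of the smallest subring containing the image of \<open>\<phi>\<close> and closed under a
  choice \<open>q\<close> of quasi-inverses. In \<open>QAdd n s t\<close> the first \<open>n\<close> generators are passed to \<open>s\<close>, the
  others to \<open>t\<close>; similarly for \<open>QMul\<close>.
\<close>

datatype qterm = QGen | QAdd nat qterm qterm | QMul nat qterm qterm | QNeg qterm | QInv qterm

instance qterm :: countable
  by countable_datatype

primrec qval :: "('c, 'm) ring_scheme \<Rightarrow> ('a \<Rightarrow> 'c) \<Rightarrow> ('c \<Rightarrow> 'c) \<Rightarrow> qterm \<Rightarrow> 'a list \<Rightarrow> 'c" where
  "qval S \<phi> q QGen ls = (case ls of [] \<Rightarrow> \<zero>\<^bsub>S\<^esub> | x # _ \<Rightarrow> \<phi> x)"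
| "qval S \<phi> q (QAdd n s t) ls = qval S \<phi> q s (take n ls) \<oplus>\<^bsub>S\<^esub> qval S \<phi> q t (drop n ls)"
| "qval S \<phi> q (QMul n s t) ls = qval S \<phi> q s (take n ls) \<otimes>\<^bsub>S\<^esub> qval S \<phi> q t (drop n ls)"
| "qval S \<phi> q (QNeg t) ls = \<ominus>\<^bsub>S\<^esub> qval S \<phi> q t ls"
| "qval S \<phi> q (QInv t) ls = q (qval S \<phi> q t ls)"

theorem regular_rank_functionI:
  fixes R :: "('a, 'm) ring_scheme" and S :: "('c, 'n) ring_scheme"
  assumes rk: "sylvester_rank_function R rk"
    and vN: "von_neumann_regular_ring S"
    and hom: "\<phi> \<in> ring_hom R S"
    and rkS: "sylvester_rank_function S rkS"
    and eq: "\<And>A. A \<in> mats R \<Longrightarrow> rk A = rkS (map_mat \<phi> A)"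
  shows "rk \<in> regular_rank_functions R"
proof -
  interpret R: sylvester_rank_function R rk by fact
  interpret S: von_neumann_regular_ring S by fact
  obtain q where q: "\<And>s. s \<in> carrier S \<Longrightarrow> q s \<in> carrier S"
      "\<And>s. s \<in> carrier S \<Longrightarrow> s \<otimes>\<^bsub>S\<^esub> q s \<otimes>\<^bsub>S\<^esub> s = s"
    using S.regular by metis
  let ?v = "qval S \<phi> q"
  define T where "T = {?v t ls |t ls. set ls \<subseteq> carrier R}"
  have vS: "set ls \<subseteq> carrier R \<Longrightarrow> ?v t ls \<in> carrier S" for t ls
  proof (induction t arbitrary: ls)
    case QGen
    then show ?case by (cases ls) (auto intro: ring_hom_closed[OF hom])
  next
    case (QAdd n s t)
    then show ?case using set_take_subset[of n ls] set_drop_subset[of n ls] by auto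
  next
    case (QMul n s t)
    then show ?case using set_take_subset[of n ls] set_drop_subset[of n ls] by auto
  qed (auto simp: q)
  have TS: "x \<in> carrier S" if "x \<in> T" for x using that vS unfolding T_def by auto
  have T\<phi>: "\<phi> a \<in> T" if "a \<in> carrier R" for a
    unfolding T_def using that by (intro CollectI exI[of _ QGen] exI[of _ "[a]"]) auto
  have Tzero: "\<zero>\<^bsub>S\<^esub> \<in> T"
    unfolding T_def by (intro CollectI exI[of _ QGen] exI[of _ "[]"]) auto
  have Tone: "\<one>\<^bsub>S\<^esub> \<in> T"
    using T\<phi>[of "\<one>\<^bsub>R\<^esub>"] ring_hom_one[OF hom] by simp
  have Tadd: "x \<oplus>\<^bsub>S\<^esub> y \<in> T" and Tmul: "x \<otimes>\<^bsub>S\<^esub> y \<in> T" if xy: "x \<in> T" "y \<in> T" for x y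
  proof -
    obtain s ks where s: "x = ?v s ks" "set ks \<subseteq> carrier R" using xy unfolding T_def by auto
    obtain t ls where t: "y = ?v t ls" "set ls \<subseteq> carrier R" using xy unfolding T_def by auto
    show "x \<oplus>\<^bsub>S\<^esub> y \<in> T" unfolding T_def using s t
      by (intro CollectI exI[of _ "QAdd (length ks) s t"] exI[of _ "ks @ ls"]) auto
    show "x \<otimes>\<^bsub>S\<^esub> y \<in> T" unfolding T_def using s t
      by (intro CollectI exI[of _ "QMul (length ks) s t"] exI[of _ "ks @ ls"]) auto
  qed
  have Tneg: "\<ominus>\<^bsub>S\<^esub> x \<in> T" and Tq: "q x \<in> T" if x: "x \<in> T" for x
  proof -
    obtain t ls where t: "x = ?v t ls" "set ls \<subseteq> carrier R" using x unfolding T_def by auto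
    show "\<ominus>\<^bsub>S\<^esub> x \<in> T" unfolding T_def using t
      by (intro CollectI exI[of _ "QNeg t"] exI[of _ ls]) auto
    show "q x \<in> T" unfolding T_def using t
      by (intro CollectI exI[of _ "QInv t"] exI[of _ ls]) auto
  qed
  define D :: "'a list \<Rightarrow> 'c" where
    "D xs = ?v (from_nat (length (takeWhile (\<lambda>x. x = \<zero>\<^bsub>R\<^esub>) xs))) (tl (dropWhile (\<lambda>x. x = \<zero>\<^bsub>R\<^esub>) xs))" for xs
  have "D (replicate (to_nat t) \<zero>\<^bsub>R\<^esub> @ \<one>\<^bsub>R\<^esub> # ls) = ?v t ls" for t ls
  proof -
    have "takeWhile (\<lambda>x. x = \<zero>\<^bsub>R\<^esub>) (replicate (to_nat t) \<zero>\<^bsub>R\<^esub> @ \<one>\<^bsub>R\<^esub> # ls) = replicate (to_nat t) \<zero>\<^bsub>R\<^esub>"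
      using R.nonzero_ring by (subst takeWhile_append2) auto
    moreover have "dropWhile (\<lambda>x. x = \<zero>\<^bsub>R\<^esub>) (replicate (to_nat t) \<zero>\<^bsub>R\<^esub> @ \<one>\<^bsub>R\<^esub> # ls) = \<one>\<^bsub>R\<^esub> # ls"
      using R.nonzero_ring by (subst dropWhile_append2) auto
    ultimately show ?thesis by (simp add: D_def)
  qed
  then have DT: "\<exists>xs. D xs = x" if "x \<in> T" for x using that unfolding T_def by blast
  define E where "E x = (SOME xs. D xs = x)" for x
  have DE: "D (E x) = x" if "x \<in> T" for x
    unfolding E_def using someI_ex[OF DT[OF that]] .
  define S' :: "'a list ring" where
    "S' = \<lparr>carrier = E ` T, mult = \<lambda>x y. E (D x \<otimes>\<^bsub>S\<^esub> D y), one = E \<one>\<^bsub>S\<^esub>,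
           zero = E \<zero>\<^bsub>S\<^esub>, add = \<lambda>x y. E (D x \<oplus>\<^bsub>S\<^esub> D y)\<rparr>"
  note T = Tzero Tone Tadd Tmul Tneg Tq T\<phi>
  have sel: "carrier S' = E ` T" "x \<otimes>\<^bsub>S'\<^esub> y = E (D x \<otimes>\<^bsub>S\<^esub> D y)" "\<one>\<^bsub>S'\<^esub> = E \<one>\<^bsub>S\<^esub>"
      "\<zero>\<^bsub>S'\<^esub> = E \<zero>\<^bsub>S\<^esub>" "x \<oplus>\<^bsub>S'\<^esub> y = E (D x \<oplus>\<^bsub>S\<^esub> D y)" for x y
    by (simp_all add: S'_def)
  have ring: "ring S'"
  proof (rule ringI)
    show "abelian_group S'"
    proof (rule abelian_groupI)
      fix x assume "x \<in> carrier S'"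
      then obtain a where a: "x = E a" "a \<in> T" by (auto simp: sel)
      show "\<exists>y\<in>carrier S'. y \<oplus>\<^bsub>S'\<^esub> x = \<zero>\<^bsub>S'\<^esub>"
        using a by (intro bexI[of _ "E (\<ominus>\<^bsub>S\<^esub> a)"]) (auto simp: sel DE T TS S.l_neg)
    qed (auto simp: sel DE T TS S.a_ac)
    show "monoid S'"
      by (rule monoidI) (auto simp: sel DE T TS S.m_assoc)
  qed (auto simp: sel DE T TS S.l_distr S.r_distr)
  have D_hom: "D \<in> ring_hom S' S"
    by (rule ring_hom_memI) (auto simp: sel DE T TS)
  have vN': "von_neumann_regular_ring S'"
  proof (intro von_neumann_regular_ring.intro von_neumann_regular_ring_axioms.intro ring)
    show "\<one>\<^bsub>S'\<^esub> \<noteq> \<zero>\<^bsub>S'\<^esub>"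
      using DE[OF Tone] DE[OF Tzero] S.nonzero_ring by (auto simp: sel)
  next
    fix s assume "s \<in> carrier S'"
    then obtain a where a: "s = E a" "a \<in> T" by (auto simp: sel)
    then show "\<exists>t\<in>carrier S'. s \<otimes>\<^bsub>S'\<^esub> t \<otimes>\<^bsub>S'\<^esub> s = s"
      by (intro bexI[of _ "E (q a)"]) (auto simp: sel DE T TS q)
  qed
  have hom': "(\<lambda>a. E (\<phi> a)) \<in> ring_hom R S'"
    by (rule ring_hom_memI)
      (auto simp: sel DE T ring_hom_mult[OF hom] ring_hom_add[OF hom] ring_hom_one[OF hom])
  have rk': "sylvester_rank_function S' (\<lambda>A. rkS (map_mat D A))"
    by (rule sylvester_rank_function_pullback[OF D_hom ring rkS])
  have "rk A = rkS (map_mat D (map_mat (\<lambda>a. E (\<phi> a)) A))" if A: "A \<in> mats R" for A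
  proof -
    have "map_mat D (map_mat (\<lambda>a. E (\<phi> a)) A) = map_mat \<phi> A"
      by (rule eq_matI) (auto simp: DE T\<phi> mats_entry[OF A])
    then show ?thesis using eq[OF A] by simp
  qed
  then show ?thesis
    unfolding regular_rank_functions_def using rk vN' hom' rk' by blast
qed

section \<open>Unital C*-algebras and dimension functions\<close>

record 'a cstar = "(complex, 'a) module" +
  star :: "'a \<Rightarrow> 'a"
  alg_norm :: "'a \<Rightarrow> real"

locale unital_cstar_algebra = ring \<A> for \<A> :: "('a, 'm) cstar_scheme" (structure) +
  assumes nonzero_ring: "\<one> \<noteq> \<zero>"
    and scale_closed: "x \<in> carrier \<A> \<Longrightarrow> c \<odot> x \<in> carrier \<A>"
    and scale_add_left: "x \<in> carrier \<A> \<Longrightarrow> (c + d) \<odot> x = c \<odot> x \<oplus> d \<odot> x"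
    and scale_add_right: "\<lbrakk>x \<in> carrier \<A>; y \<in> carrier \<A>\<rbrakk> \<Longrightarrow> c \<odot> (x \<oplus> y) = c \<odot> x \<oplus> c \<odot> y"
    and scale_scale: "x \<in> carrier \<A> \<Longrightarrow> (c * d) \<odot> x = c \<odot> (d \<odot> x)"
    and scale_one: "x \<in> carrier \<A> \<Longrightarrow> 1 \<odot> x = x"
    and scale_mult_left: "\<lbrakk>x \<in> carrier \<A>; y \<in> carrier \<A>\<rbrakk> \<Longrightarrow> (c \<odot> x) \<otimes> y = c \<odot> (x \<otimes> y)"
    and scale_mult_right: "\<lbrakk>x \<in> carrier \<A>; y \<in> carrier \<A>\<rbrakk> \<Longrightarrow> x \<otimes> (c \<odot> y) = c \<odot> (x \<otimes> y)"
    and star_closed: "x \<in> carrier \<A> \<Longrightarrow> star \<A> x \<in> carrier \<A>"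
    and star_star: "x \<in> carrier \<A> \<Longrightarrow> star \<A> (star \<A> x) = x"
    and star_add: "\<lbrakk>x \<in> carrier \<A>; y \<in> carrier \<A>\<rbrakk> \<Longrightarrow> star \<A> (x \<oplus> y) = star \<A> x \<oplus> star \<A> y"
    and star_scale: "x \<in> carrier \<A> \<Longrightarrow> star \<A> (c \<odot> x) = cnj c \<odot> star \<A> x"
    and star_mult: "\<lbrakk>x \<in> carrier \<A>; y \<in> carrier \<A>\<rbrakk> \<Longrightarrow> star \<A> (x \<otimes> y) = star \<A> y \<otimes> star \<A> x"
    and norm_nonneg: "x \<in> carrier \<A> \<Longrightarrow> 0 \<le> alg_norm \<A> x"
    and norm_eq_zero: "x \<in> carrier \<A> \<Longrightarrow> alg_norm \<A> x = 0 \<longleftrightarrow> x = \<zero>"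
    and norm_triangle: "\<lbrakk>x \<in> carrier \<A>; y \<in> carrier \<A>\<rbrakk>
      \<Longrightarrow> alg_norm \<A> (x \<oplus> y) \<le> alg_norm \<A> x + alg_norm \<A> y"
    and norm_scale: "x \<in> carrier \<A> \<Longrightarrow> alg_norm \<A> (c \<odot> x) = cmod c * alg_norm \<A> x"
    and norm_mult: "\<lbrakk>x \<in> carrier \<A>; y \<in> carrier \<A>\<rbrakk>
      \<Longrightarrow> alg_norm \<A> (x \<otimes> y) \<le> alg_norm \<A> x * alg_norm \<A> y"
    and cstar_identity: "x \<in> carrier \<A> \<Longrightarrow> alg_norm \<A> (star \<A> x \<otimes> x) = (alg_norm \<A> x)\<^sup>2"
    and complete: "\<lbrakk>\<And>n. X n \<in> carrier \<A>;
        \<And>e. 0 < e \<Longrightarrow> \<exists>N. \<forall>m\<ge>N. \<forall>n\<ge>N. alg_norm \<A> (X m \<ominus> X n) < e\<rbrakk>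
      \<Longrightarrow> \<exists>x\<in>carrier \<A>. (\<lambda>n. alg_norm \<A> (X n \<ominus> x)) \<longlonglongrightarrow> 0"

definition adjoint_mat :: "('a, 'm) cstar_scheme \<Rightarrow> 'a mat \<Rightarrow> 'a mat" where
  "adjoint_mat \<A> A = mat (dim_col A) (dim_row A) (\<lambda>(i, j). star \<A> (A $$ (j, i)))"

text \<open>
  The norm of a rectangular matrix \<open>A\<close> over \<open>\<A>\<close> is its C*-norm, that is, the operator norm of
  \<open>X \<mapsto> A X\<close> between the Hilbert modules of columns with entries in \<open>\<A>\<close>, a column \<open>X\<close> having norm
  \<open>\<parallel>X\<^sup>* X\<parallel>\<close> to the power \<open>1/2\<close>.
\<close>

definition column_norm :: "('a, 'm) cstar_scheme \<Rightarrow> 'a mat \<Rightarrow> real" where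
  "column_norm \<A> X = sqrt (alg_norm \<A> (mat_prod \<A> (adjoint_mat \<A> X) X $$ (0, 0)))"

definition mat_norm :: "('a, 'm) cstar_scheme \<Rightarrow> 'a mat \<Rightarrow> real" where
  "mat_norm \<A> A = Sup {column_norm \<A> (mat_prod \<A> A X) |X.
     X \<in> mats \<A> \<and> dim_row X = dim_col A \<and> dim_col X = 1 \<and> column_norm \<A> X \<le> 1}"

definition cuntz_le :: "('a, 'm) cstar_scheme \<Rightarrow> 'a mat \<Rightarrow> 'a mat \<Rightarrow> bool" where
  "cuntz_le \<A> A B \<longleftrightarrow> (\<exists>C D.
     (\<forall>n. C n \<in> mats \<A> \<and> dim_row (C n) = dim_row A \<and> dim_col (C n) = dim_row B) \<and>
     (\<forall>n. D n \<in> mats \<A> \<and> dim_row (D n) = dim_col B \<and> dim_col (D n) = dim_col A) \<and>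
     (\<lambda>n. mat_norm \<A> (mat_diff \<A> (mat_prod \<A> (mat_prod \<A> (C n) B) (D n)) A)) \<longlonglongrightarrow> 0)"

definition dimension_function :: "('a, 'm) cstar_scheme \<Rightarrow> ('a mat \<Rightarrow> real) \<Rightarrow> bool" where
  "dimension_function \<A> \<phi> \<longleftrightarrow>
     (\<forall>A\<in>mats \<A>. 0 \<le> \<phi> A) \<and>
     (\<forall>A\<in>mats \<A>. \<forall>B\<in>mats \<A>. cuntz_le \<A> A B \<longrightarrow> \<phi> A \<le> \<phi> B) \<and>
     \<phi> (matrix_of_elem \<one>\<^bsub>\<A>\<^esub>) = 1 \<and>
     (\<forall>A\<in>mats \<A>. \<forall>B\<in>mats \<A>. \<phi> (block_diag \<A> A B) = \<phi> A + \<phi> B)"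

section \<open>The C*-algebra of continuous functions on the unit interval\<close>

definition C01 :: "(real \<Rightarrow> complex) cstar" where
  "C01 = \<lparr>carrier = {h \<in> extensional {0..1}. continuous_on {0..1} h},
     mult = \<lambda>h k. \<lambda>x\<in>{0..1}. h x * k x,
     one = \<lambda>x\<in>{0..1}. 1,
     zero = \<lambda>x\<in>{0..1}. 0,
     add = \<lambda>h k. \<lambda>x\<in>{0..1}. h x + k x,
     smult = \<lambda>c h. \<lambda>x\<in>{0..1}. c * h x,
     star = \<lambda>h. \<lambda>x\<in>{0..1}. cnj (h x),
     alg_norm = \<lambda>h. SUP x\<in>{0..1}. cmod (h x)\<rparr>"

definition f_fun :: "real \<Rightarrow> complex" where
  "f_fun = (\<lambda>x\<in>{0..1}. complex_of_real x)"

definition g_fun :: "real \<Rightarrow> complex" where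
  "g_fun = (\<lambda>x\<in>{0..1}. if x = 0 then 0 else complex_of_real (1 / ln (2 / x)))"

lemma C01_sel:
  "carrier C01 = {h \<in> extensional {0..1}. continuous_on {0..1} h}"
  "h \<otimes>\<^bsub>C01\<^esub> k = (\<lambda>x\<in>{0..1}. h x * k x)"
  "\<one>\<^bsub>C01\<^esub> = (\<lambda>x\<in>{0..1}. 1)"
  "\<zero>\<^bsub>C01\<^esub> = (\<lambda>x\<in>{0..1}. 0)"
  "h \<oplus>\<^bsub>C01\<^esub> k = (\<lambda>x\<in>{0..1}. h x + k x)"
  "c \<odot>\<^bsub>C01\<^esub> h = (\<lambda>x\<in>{0..1}. c * h x)"
  "star C01 h = (\<lambda>x\<in>{0..1}. cnj (h x))"
  "alg_norm C01 h = (SUP x\<in>{0..1}. cmod (h x))"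
  by (simp_all add: C01_def)

lemma C01_I: "continuous_on {0..1} h \<Longrightarrow> (\<lambda>x\<in>{0..1}. h x) \<in> carrier C01"
  unfolding C01_sel using continuous_on_cong[of "{0..1}" "{0..1}" "\<lambda>x\<in>{0..1}. h x" h] by auto

lemma C01_D: "h \<in> carrier C01 \<Longrightarrow> continuous_on {0..1} h" "h \<in> carrier C01 \<Longrightarrow> h \<in> extensional {0..1}"
  by (auto simp: C01_sel)

lemma C01_eqI:
  assumes "h \<in> extensional {0..1}" "k \<in> extensional {0..1}" "\<And>x. 0 \<le> x \<Longrightarrow> x \<le> 1 \<Longrightarrow> h x = k x"
  shows "h = (k :: real \<Rightarrow> complex)"
  by (rule extensionalityI[OF assms(1,2)]) (use assms(3) in auto)

lemma cring_C01: "cring C01"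
proof (rule cringI)
  show "abelian_group C01"
  proof (rule abelian_groupI)
    fix h assume h: "h \<in> carrier C01"
    show "\<exists>k\<in>carrier C01. k \<oplus>\<^bsub>C01\<^esub> h = \<zero>\<^bsub>C01\<^esub>"
      using C01_D[OF h]
      by (intro bexI[of _ "\<lambda>x\<in>{0..1}. - h x"] C01_I) (auto simp: C01_sel intro!: C01_eqI continuous_intros)
    show "\<zero>\<^bsub>C01\<^esub> \<oplus>\<^bsub>C01\<^esub> h = h"
      using C01_D[OF h] by (auto simp: C01_sel intro!: C01_eqI)
  next
    fix h k assume "h \<in> carrier C01" "k \<in> carrier C01"
    then show "h \<oplus>\<^bsub>C01\<^esub> k \<in> carrier C01"
      unfolding C01_sel(5) by (intro C01_I continuous_intros C01_D)
  next
    show "\<zero>\<^bsub>C01\<^esub> \<in> carrier C01"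
      unfolding C01_sel(4) by (intro C01_I continuous_intros)
  qed (auto simp: C01_sel algebra_simps intro!: C01_eqI)
  show "comm_monoid C01"
  proof (rule comm_monoidI)
    fix h k assume "h \<in> carrier C01" "k \<in> carrier C01"
    then show "h \<otimes>\<^bsub>C01\<^esub> k \<in> carrier C01"
      unfolding C01_sel(2) by (intro C01_I continuous_intros C01_D)
  next
    show "\<one>\<^bsub>C01\<^esub> \<in> carrier C01"
      unfolding C01_sel(3) by (intro C01_I continuous_intros)
  qed (auto simp: C01_sel algebra_simps intro!: C01_eqI)
qed (auto simp: C01_sel algebra_simps intro!: C01_eqI)

lemma C01_minus:
  assumes h: "h \<in> carrier C01" and k: "k \<in> carrier C01"
  shows "h \<ominus>\<^bsub>C01\<^esub> k = (\<lambda>x\<in>{0..1}. h x - k x)"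
proof -
  interpret cring C01 by (rule cring_C01)
  have k': "(\<lambda>x\<in>{0..1}. - k x) \<in> carrier C01"
    using k by (intro C01_I continuous_intros C01_D)
  have "\<ominus>\<^bsub>C01\<^esub> k = (\<lambda>x\<in>{0..1}. - k x)"
    by (rule minus_equality[OF _ k k']) (auto simp: C01_sel intro!: C01_eqI)
  then show ?thesis
    by (auto simp: minus_eq C01_sel intro!: C01_eqI)
qed

lemma C01_norm_le_iff:
  assumes "h \<in> carrier C01"
  shows "alg_norm C01 h \<le> b \<longleftrightarrow> (\<forall>x\<in>{0..1}. cmod (h x) \<le> b)"
proof -
  have "compact ((\<lambda>x. cmod (h x)) ` {0..1})"
    by (intro compact_continuous_image continuous_intros C01_D assms) auto
  then have "bdd_above ((\<lambda>x. cmod (h x)) ` {0..1})"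
    by (intro bounded_imp_bdd_above compact_imp_bounded)
  then show ?thesis
    unfolding C01_sel by (intro cSUP_le_iff) auto
qed

lemma C01_norm_ge: "h \<in> carrier C01 \<Longrightarrow> 0 \<le> x \<Longrightarrow> x \<le> 1 \<Longrightarrow> cmod (h x) \<le> alg_norm C01 h"
  using C01_norm_le_iff[of h "alg_norm C01 h"] by auto

lemma unital_cstar_algebra_C01: "unital_cstar_algebra C01"
proof -
  interpret cring C01 by (rule cring_C01)
  have scale: "c \<odot>\<^bsub>C01\<^esub> h \<in> carrier C01" if "h \<in> carrier C01" for c h
    using that unfolding C01_sel(6) by (intro C01_I continuous_intros C01_D)
  have star: "star C01 h \<in> carrier C01" if "h \<in> carrier C01" for h
    using that unfolding C01_sel(7) by (intro C01_I continuous_intros C01_D)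
  have nonneg: "0 \<le> alg_norm C01 h" if "h \<in> carrier C01" for h
    using C01_norm_ge[OF that, of 0] norm_ge_zero[of "h 0"] by linarith
  have normI: "alg_norm C01 h \<le> b" if "h \<in> carrier C01" "\<And>x. 0 \<le> x \<Longrightarrow> x \<le> 1 \<Longrightarrow> cmod (h x) \<le> b" for h b
    using that by (auto simp: C01_norm_le_iff)
  have scale_le: "alg_norm C01 (c \<odot>\<^bsub>C01\<^esub> h) \<le> cmod c * alg_norm C01 h" if "h \<in> carrier C01" for c h
    using that by (intro normI scale) (auto simp: C01_sel(6) norm_mult intro!: mult_left_mono C01_norm_ge)
  have inv_scale: "(1 / c) \<odot>\<^bsub>C01\<^esub> (c \<odot>\<^bsub>C01\<^esub> h) = h" if "h \<in> carrier C01" "c \<noteq> 0" for c h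
    using that C01_D[OF that(1)] by (auto simp: C01_sel(6) intro!: C01_eqI)
  show ?thesis
  proof
    have "\<one>\<^bsub>C01\<^esub> 0 \<noteq> \<zero>\<^bsub>C01\<^esub> 0" by (simp add: C01_sel)
    then show "\<one>\<^bsub>C01\<^esub> \<noteq> \<zero>\<^bsub>C01\<^esub>" by metis
  next
    fix h assume h: "h \<in> carrier C01"
    note ext = C01_D(2)[OF h]
    show "star C01 h \<in> carrier C01" "0 \<le> alg_norm C01 h" using h star nonneg by auto
    show "1 \<odot>\<^bsub>C01\<^esub> h = h" using ext by (auto simp: C01_sel intro!: C01_eqI)
    show "star C01 (star C01 h) = h" using ext by (auto simp: C01_sel intro!: C01_eqI)
    show "alg_norm C01 h = 0 \<longleftrightarrow> h = \<zero>\<^bsub>C01\<^esub>"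
    proof
      assume "alg_norm C01 h = 0"
      then show "h = \<zero>\<^bsub>C01\<^esub>"
        using C01_norm_ge[OF h] ext by (auto simp: C01_sel(4) intro!: C01_eqI)
    next
      assume "h = \<zero>\<^bsub>C01\<^esub>"
      then have "alg_norm C01 h \<le> 0" by (intro normI h) (simp add: C01_sel(4))
      then show "alg_norm C01 h = 0" using nonneg[OF h] by simp
    qed
    show "alg_norm C01 (star C01 h \<otimes>\<^bsub>C01\<^esub> h) = (alg_norm C01 h)\<^sup>2"
    proof (rule antisym)
      have sh: "star C01 h \<otimes>\<^bsub>C01\<^esub> h \<in> carrier C01" using h star by blast
      have val: "cmod ((star C01 h \<otimes>\<^bsub>C01\<^esub> h) x) = (cmod (h x))\<^sup>2" if "0 \<le> x" "x \<le> 1" for x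
        using that by (simp add: C01_sel(2,7) norm_mult power2_eq_square)
      show "alg_norm C01 (star C01 h \<otimes>\<^bsub>C01\<^esub> h) \<le> (alg_norm C01 h)\<^sup>2"
        by (intro normI sh) (auto simp: val intro!: power_mono C01_norm_ge h)
      have "cmod (h x) \<le> sqrt (alg_norm C01 (star C01 h \<otimes>\<^bsub>C01\<^esub> h))" if "0 \<le> x" "x \<le> 1" for x
        using C01_norm_ge[OF sh that] val[OF that] by (intro real_le_rsqrt) simp
      then have "alg_norm C01 h \<le> sqrt (alg_norm C01 (star C01 h \<otimes>\<^bsub>C01\<^esub> h))"
        by (intro normI h)
      then show "(alg_norm C01 h)\<^sup>2 \<le> alg_norm C01 (star C01 h \<otimes>\<^bsub>C01\<^esub> h)"
        using nonneg[OF h] nonneg[OF sh] by (metis power_mono real_sqrt_pow2)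
    qed
    fix c
    show "c \<odot>\<^bsub>C01\<^esub> h \<in> carrier C01" using h scale by auto
    show "alg_norm C01 (c \<odot>\<^bsub>C01\<^esub> h) = cmod c * alg_norm C01 h"
    proof (cases "c = 0")
      case True
      then show ?thesis
        using nonneg[OF scale[OF h], of c] scale_le[OF h, of c] by simp
    next
      case False
      have "alg_norm C01 h \<le> cmod (1 / c) * alg_norm C01 (c \<odot>\<^bsub>C01\<^esub> h)"
        using scale_le[OF scale[OF h], of "1 / c" c] inv_scale[OF h False] by simp
      then have "cmod c * alg_norm C01 h \<le> alg_norm C01 (c \<odot>\<^bsub>C01\<^esub> h)"
        using False by (simp add: norm_divide field_simps)
      then show ?thesis using scale_le[OF h, of c] by simp
    qed
  next
    fix h k assume hk: "h \<in> carrier C01" "k \<in> carrier C01"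
    show "alg_norm C01 (h \<oplus>\<^bsub>C01\<^esub> k) \<le> alg_norm C01 h + alg_norm C01 k"
      using hk by (intro normI add.m_closed)
        (auto simp: C01_sel(5) intro!: norm_triangle_le add_mono C01_norm_ge)
    show "alg_norm C01 (h \<otimes>\<^bsub>C01\<^esub> k) \<le> alg_norm C01 h * alg_norm C01 k"
      using hk by (intro normI m_closed)
        (auto simp: C01_sel(2) norm_mult intro!: mult_mono C01_norm_ge nonneg)
  next
    fix X :: "nat \<Rightarrow> real \<Rightarrow> complex"
    assume X: "\<And>n. X n \<in> carrier C01"
      and Cauchy: "\<And>e. 0 < e \<Longrightarrow> \<exists>N. \<forall>m\<ge>N. \<forall>n\<ge>N. alg_norm C01 (X m \<ominus>\<^bsub>C01\<^esub> X n) < e"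
    have diff: "(\<lambda>x\<in>{0..1}. h x - k x) \<in> carrier C01" if "h \<in> carrier C01" "k \<in> carrier C01" for h k
      using that C01_minus[OF that] by (metis minus_closed)
    have "uniformly_Cauchy_on {0..1} X"
    proof (rule uniformly_Cauchy_onI)
      fix e :: real assume "0 < e"
      then obtain N where N: "\<And>m n. m \<ge> N \<Longrightarrow> n \<ge> N \<Longrightarrow> alg_norm C01 (X m \<ominus>\<^bsub>C01\<^esub> X n) < e"
        using Cauchy by blast
      have "dist (X m x) (X n x) < e" if "x \<in> {0..1}" "m \<ge> N" "n \<ge> N" for x m n
        using N[OF that(2,3)] C01_norm_ge[OF diff[OF X X], of x m n] that(1)
        by (auto simp: C01_minus[OF X X] dist_norm)
      then show "\<exists>M. \<forall>x\<in>{0..1}. \<forall>m\<ge>M. \<forall>n\<ge>M. dist (X m x) (X n x) < e" by blast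
    qed
    then have "uniformly_convergent_on {0..1} X" by (rule Cauchy_uniformly_convergent)
    then obtain l where l: "uniform_limit {0..1} X l sequentially"
      unfolding uniformly_convergent_on_def by blast
    have "continuous_on {0..1} l"
      by (rule uniform_limit_theorem[OF _ l]) (auto intro: always_eventually C01_D X)
    then have L: "(\<lambda>x\<in>{0..1}. l x) \<in> carrier C01" by (rule C01_I)
    have "(\<lambda>n. alg_norm C01 (X n \<ominus>\<^bsub>C01\<^esub> (\<lambda>x\<in>{0..1}. l x))) \<longlonglongrightarrow> 0"
    proof (rule LIMSEQ_I)
      fix e :: real assume e: "0 < e"
      then obtain N where N: "\<And>n x. n \<ge> N \<Longrightarrow> x \<in> {0..1} \<Longrightarrow> dist (X n x) (l x) < e / 2"
        using l unfolding uniform_limit_sequentially_iff by (meson half_gt_zero)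
      have "norm (alg_norm C01 (X n \<ominus>\<^bsub>C01\<^esub> (\<lambda>x\<in>{0..1}. l x)) - 0) < e" if n: "n \<ge> N" for n
      proof -
        have "alg_norm C01 (X n \<ominus>\<^bsub>C01\<^esub> (\<lambda>x\<in>{0..1}. l x)) \<le> e / 2"
          using N[OF n] by (intro normI minus_closed X L)
            (auto simp: C01_minus[OF X L] dist_norm intro!: less_imp_le)
        then show ?thesis using nonneg[OF minus_closed[OF X L], of n] e by simp
      qed
      then show "\<exists>N. \<forall>n\<ge>N. norm (alg_norm C01 (X n \<ominus>\<^bsub>C01\<^esub> (\<lambda>x\<in>{0..1}. l x)) - 0) < e" by blast
    qed
    then show "\<exists>x\<in>carrier C01. (\<lambda>n. alg_norm C01 (X n \<ominus>\<^bsub>C01\<^esub> x)) \<longlonglongrightarrow> 0"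
      using L by blast
  qed (auto simp: C01_sel algebra_simps intro!: C01_eqI)
qed

lemma f_fun_C01: "f_fun \<in> carrier C01"
  unfolding f_fun_def by (intro C01_I continuous_intros)

lemma g_fun_C01: "g_fun \<in> carrier C01"
proof -
  have lim: "((\<lambda>x::real. 1 / ln (2 / x)) \<longlongrightarrow> 0) (at_right 0)"
    by real_asymp
  have cont: "continuous_on {0..1} (\<lambda>x::real. if x = 0 then 0 else 1 / ln (2 / x))" (is "continuous_on _ ?g")
    unfolding continuous_on_def
  proof
    fix x :: real assume x: "x \<in> {0..1}"
    show "(?g \<longlongrightarrow> ?g x) (at x within {0..1})"
    proof (cases "x = 0")
      case True
      have "(?g \<longlongrightarrow> 0) (at_right 0)"
        by (rule Lim_transform_eventually[OF lim]) (auto simp: eventually_at_filter)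
      then show ?thesis
        using True by (simp add: at_within_Icc_at_right)
    next
      case False
      then have "x > 0" "ln (2 / x) \<noteq> 0" using x by auto
      then have "((\<lambda>x. 1 / ln (2 / x)) \<longlongrightarrow> 1 / ln (2 / x)) (at x within {0..1})"
        by (intro tendsto_intros) auto
      moreover have "\<forall>\<^sub>F y in at x within {0..1}. 1 / ln (2 / y) = ?g y"
      proof -
        have "\<forall>\<^sub>F y in at x within {0..1}. y > 0"
          using order_tendstoD(1)[OF tendsto_ident_at \<open>x > 0\<close>] .
        then show ?thesis by eventually_elim auto
      qed
      ultimately show ?thesis using False by (auto intro: Lim_transform_eventually)
    qed
  qed
  have "g_fun = (\<lambda>x\<in>{0..1}. complex_of_real (?g x))"
    by (auto simp: g_fun_def)
  then show ?thesis
    using C01_I[OF continuous_on_of_real[OF cont]] by simp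
qed

end

theory Submission
  imports Defs "HOL-Algebra.Ring_Divisibility"
begin

text \<open>
  Functions on \<open>(0, 1]\<close> bounded by some \<open>C (1 + log (2/x))\<^sup>m\<close> form a ring in which \<open>g\<close> is a unit
  but \<open>f\<close> is not, as \<open>1/x\<close> grows too fast. A maximal ideal containing \<open>f\<close> thus yields a homomorphism
  from \<open>C([0,1])\<close> to a field that kills \<open>f\<close> and not \<open>g\<close>; pull back the rank of matrices over
  this field. It is not a dimension function because \<open>g\<close> is the norm limit of
  \<open>(g / max(x, 1/n)) f\<close>.
\<close>

section \<open>The rank of a matrix over a field\<close>

text \<open>The obstacle is that no point evaluation of \<open>C01\<close> will do: the only one
  that kills \<open>f_fun\<close> is the one at 0, and it kills \<open>g_fun\<close> as well. The
  kernel of the homomorphism has to be a prime ideal that contains \<open>f_fun\<close> but not its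
  norm limit \<open>g_fun\<close>, so it is neither closed nor maximal. Such an ideal exists because
  no power of g is a multiple of f: the quotient g^m / f is unbounded near 0 for every m. Dropping
  the point 0 and continuity makes room for 1/g = log(2/x), and closure under products then calls
  for all polynomials in log(2/x), which still grow too slowly to include 1/f. The 2 in log(2/x)
  keeps the logarithm positive up to x = 1. The separation from dimension functions has the same
  source: rank functions respect exact products, whereas Cuntz comparison also admits limits, here
  with multipliers of f whose norms tend to infinity. The target can be a field because fields are
  von Neumann regular.\<close>

text \<open>Factorization rank: a matrix that is a sum of at most \<open>r\<close> outer products.
  Arbitrary row and column sets \<open>P\<close>, \<open>Q\<close> make a block of a matrix a mere
  restriction, and an arbitrary finite \<open>I\<close> with a bound on its cardinality allows
  single terms to be deleted without renumbering.\<close>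

definition rank_le ::
  "('a, 'm) ring_scheme \<Rightarrow> 'i set \<Rightarrow> 'j set \<Rightarrow> ('i \<Rightarrow> 'j \<Rightarrow> 'a) \<Rightarrow> nat \<Rightarrow> bool" where
  "rank_le R P Q a r \<longleftrightarrow> (\<exists>(I :: nat set) X Y. finite I \<and> card I \<le> r \<and>
     X \<in> I \<rightarrow> P \<rightarrow> carrier R \<and> Y \<in> I \<rightarrow> Q \<rightarrow> carrier R \<and>
     (\<forall>i\<in>P. \<forall>j\<in>Q. a i j = (\<Oplus>\<^bsub>R\<^esub>k\<in>I. X k i \<otimes>\<^bsub>R\<^esub> Y k j)))"

lemma rank_leI:
  fixes I :: "nat set"
  assumes "finite I" "card I \<le> r" "X \<in> I \<rightarrow> P \<rightarrow> carrier R" "Y \<in> I \<rightarrow> Q \<rightarrow> carrier R"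
    and "\<And>i j. i \<in> P \<Longrightarrow> j \<in> Q \<Longrightarrow> a i j = (\<Oplus>\<^bsub>R\<^esub>k\<in>I. X k i \<otimes>\<^bsub>R\<^esub> Y k j)"
  shows "rank_le R P Q a r"
  unfolding rank_le_def using assms by (intro exI conjI ballI) auto

lemma rank_leE:
  assumes "rank_le R P Q a r"
  obtains I :: "nat set" and X Y where "finite I" "card I \<le> r"
    "X \<in> I \<rightarrow> P \<rightarrow> carrier R" "Y \<in> I \<rightarrow> Q \<rightarrow> carrier R"
    "\<forall>i\<in>P. \<forall>j\<in>Q. a i j = (\<Oplus>\<^bsub>R\<^esub>k\<in>I. X k i \<otimes>\<^bsub>R\<^esub> Y k j)"
  using assms unfolding rank_le_def by blast

lemma rank_le_cong:
  assumes "rank_le R P Q a r" "\<And>i j. i \<in> P \<Longrightarrow> j \<in> Q \<Longrightarrow> b i j = a i j"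
  shows "rank_le R P Q b r"
  using assms(1) by (rule rank_leE) (rule rank_leI, use assms(2) in auto)

lemma (in abelian_monoid) finsum_swap:
  assumes "finite A" "finite B" "\<And>x y. x \<in> A \<Longrightarrow> y \<in> B \<Longrightarrow> f x y \<in> carrier G"
  shows "(\<Oplus>x\<in>A. \<Oplus>y\<in>B. f x y) = (\<Oplus>y\<in>B. \<Oplus>x\<in>A. f x y)"
  using assms(1,3)
proof (induction A)
  case (insert a A)
  then have "(\<Oplus>y\<in>B. \<Oplus>x\<in>insert a A. f x y) = (\<Oplus>y\<in>B. f a y \<oplus> (\<Oplus>x\<in>A. f x y))"
    by (intro finsum_cong') (auto intro!: add.finprod_insert)
  with insert show ?case
    by (simp add: finsum_addf Pi_iff)
qed simp

section \<open>Calculus of factorizations over a commutative ring\<close>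

context cring
begin

lemma rank_le_zero: "rank_le R P Q (\<lambda>_ _. \<zero>) 0"
  by (rule rank_leI[of "{}"]) auto

lemma rank_le_outer:
  assumes "u \<in> P \<rightarrow> carrier R" "v \<in> Q \<rightarrow> carrier R"
  shows "rank_le R P Q (\<lambda>i j. u i \<otimes> v j) 1"
  by (rule rank_leI[of "{0}" _ "\<lambda>_. u" _ _ "\<lambda>_. v"]) (use assms in \<open>auto simp: Pi_iff\<close>)

lemma rank_le_add:
  assumes "rank_le R P Q a r" "rank_le R P Q b s"
  shows "rank_le R P Q (\<lambda>i j. a i j \<oplus> b i j) (r + s)"
proof -
  obtain I :: "nat set" and X Y where a: "finite I" "card I \<le> r" "X \<in> I \<rightarrow> P \<rightarrow> carrier R" "Y \<in> I \<rightarrow> Q \<rightarrow> carrier R"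
    "\<forall>i\<in>P. \<forall>j\<in>Q. a i j = (\<Oplus>k\<in>I. X k i \<otimes> Y k j)"
    using assms(1) by (rule rank_leE)
  obtain J :: "nat set" and Z W where b: "finite J" "card J \<le> s" "Z \<in> J \<rightarrow> P \<rightarrow> carrier R" "W \<in> J \<rightarrow> Q \<rightarrow> carrier R"
    "\<forall>i\<in>P. \<forall>j\<in>Q. b i j = (\<Oplus>k\<in>J. Z k i \<otimes> W k j)"
    using assms(2) by (rule rank_leE)
  \<comment> \<open>Even and odd codes keep the two index sets disjoint inside the naturals;
    \<open>div 2\<close> decodes both.\<close>
  let ?e = "\<lambda>k::nat. 2 * k" and ?o = "\<lambda>k::nat. Suc (2 * k)"
  have disj: "?e ` I \<inter> ?o ` J = {}"
    by (metis (no_types, lifting) disjoint_iff dvd_triv_left even_Suc imageE)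
  have inj: "inj_on ?e I" "inj_on ?o J" by (auto intro: inj_onI)
  let ?X = "\<lambda>k. if even k then X (k div 2) else Z (k div 2)"
  let ?Y = "\<lambda>k. if even k then Y (k div 2) else W (k div 2)"
  show ?thesis
  proof (rule rank_leI[of "?e ` I \<union> ?o ` J" _ ?X _ _ ?Y])
    show "card (?e ` I \<union> ?o ` J) \<le> r + s"
      using a b by (simp add: card_Un_disjoint[OF _ _ disj] card_image[OF inj(1)] card_image[OF inj(2)])
  next
    fix i j assume ij: "i \<in> P" "j \<in> Q"
    have "(\<Oplus>k\<in>?e ` I \<union> ?o ` J. ?X k i \<otimes> ?Y k j)
        = (\<Oplus>k\<in>?e ` I. ?X k i \<otimes> ?Y k j) \<oplus> (\<Oplus>k\<in>?o ` J. ?X k i \<otimes> ?Y k j)"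
      using a b ij by (intro finsum_Un_disjoint disj) (auto simp: Pi_iff)
    also have "(\<Oplus>k\<in>?e ` I. ?X k i \<otimes> ?Y k j) = (\<Oplus>k\<in>I. X k i \<otimes> Y k j)"
      using a ij by (subst finsum_reindex[OF _ inj(1)]) (auto simp: Pi_iff)
    also have "(\<Oplus>k\<in>?o ` J. ?X k i \<otimes> ?Y k j) = (\<Oplus>k\<in>J. Z k i \<otimes> W k j)"
      using b ij by (subst finsum_reindex[OF _ inj(2)]) (auto simp: Pi_iff)
    finally show "a i j \<oplus> b i j = (\<Oplus>k\<in>?e ` I \<union> ?o ` J. ?X k i \<otimes> ?Y k j)"
      using a b ij by simp
  qed (use a b in \<open>auto simp: Pi_iff\<close>)
qed

text \<open>Setting the factors \<open>X k i\<close> and \<open>Y k j\<close> to zero outside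
  \<open>p\<close> and \<open>q\<close> pads a matrix by zeros without new terms. This embeds a
  diagonal block into a larger matrix and also shifts a block back to the origin.\<close>

lemma rank_le_reindex:
  assumes "rank_le R P Q a r"
    and "\<And>i. i \<in> P' \<Longrightarrow> p i \<Longrightarrow> f i \<in> P" "\<And>j. j \<in> Q' \<Longrightarrow> q j \<Longrightarrow> g j \<in> Q"
  shows "rank_le R P' Q' (\<lambda>i j. if p i \<and> q j then a (f i) (g j) else \<zero>) r"
proof -
  obtain I :: "nat set" and X Y where a: "finite I" "card I \<le> r" "X \<in> I \<rightarrow> P \<rightarrow> carrier R" "Y \<in> I \<rightarrow> Q \<rightarrow> carrier R"
    "\<forall>i\<in>P. \<forall>j\<in>Q. a i j = (\<Oplus>k\<in>I. X k i \<otimes> Y k j)"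
    using assms(1) by (rule rank_leE)
  let ?X = "\<lambda>k i. if p i then X k (f i) else \<zero>" and ?Y = "\<lambda>k j. if q j then Y k (g j) else \<zero>"
  show ?thesis
  proof (rule rank_leI[OF a(1,2), of ?X _ _ ?Y])
    fix i j assume ij: "i \<in> P'" "j \<in> Q'"
    have X: "?X k i \<in> carrier R" and Y: "?Y k j \<in> carrier R" if "k \<in> I" for k
      using a(3,4) assms(2)[OF ij(1)] assms(3)[OF ij(2)] that by (auto simp: Pi_iff)
    show "(if p i \<and> q j then a (f i) (g j) else \<zero>) = (\<Oplus>k\<in>I. ?X k i \<otimes> ?Y k j)"
    proof (cases "p i \<and> q j")
      case True
      then show ?thesis using a(5) assms(2)[OF ij(1)] assms(3)[OF ij(2)] by simp
    next
      case False
      then have "(\<Oplus>k\<in>I. ?X k i \<otimes> ?Y k j) = (\<Oplus>k\<in>I. \<zero>)"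
        using X Y by (intro finsum_cong') auto
      with False show ?thesis by auto
    qed
  qed (use a assms in \<open>auto simp: Pi_iff\<close>)
qed

lemma rank_le_transpose:
  assumes "rank_le R P Q a r"
  shows "rank_le R Q P (\<lambda>j i. a i j) r"
proof -
  obtain I :: "nat set" and X Y where a: "finite I" "card I \<le> r" "X \<in> I \<rightarrow> P \<rightarrow> carrier R" "Y \<in> I \<rightarrow> Q \<rightarrow> carrier R"
    "\<forall>i\<in>P. \<forall>j\<in>Q. a i j = (\<Oplus>k\<in>I. X k i \<otimes> Y k j)"
    using assms(1) by (rule rank_leE)
  show ?thesis
  proof (rule rank_leI[OF a(1,2,4,3)])
    fix j i assume ij: "j \<in> Q" "i \<in> P"
    then show "a i j = (\<Oplus>k\<in>I. Y k j \<otimes> X k i)"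
      using a by (auto simp: Pi_iff m_comm intro!: finsum_cong')
  qed
qed

text \<open>Associativity: if \<open>a\<close> factors as X Y, then \<open>a\<close> times
  \<open>b\<close> is X (Y b), with the same inner index set.\<close>

lemma rank_le_mult_left:
  assumes "rank_le R P L a r" "finite L" "b \<in> L \<rightarrow> Q \<rightarrow> carrier R"
  shows "rank_le R P Q (\<lambda>i j. \<Oplus>l\<in>L. a i l \<otimes> b l j) r"
proof -
  obtain I :: "nat set" and X Y where a: "finite I" "card I \<le> r" "X \<in> I \<rightarrow> P \<rightarrow> carrier R" "Y \<in> I \<rightarrow> L \<rightarrow> carrier R"
    "\<forall>i\<in>P. \<forall>j\<in>L. a i j = (\<Oplus>k\<in>I. X k i \<otimes> Y k j)"
    using assms(1) by (rule rank_leE)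
  show ?thesis
  proof (rule rank_leI[OF a(1,2,3), of "\<lambda>k j. \<Oplus>l\<in>L. Y k l \<otimes> b l j"])
    show "(\<lambda>k j. \<Oplus>l\<in>L. Y k l \<otimes> b l j) \<in> I \<rightarrow> Q \<rightarrow> carrier R"
      using a assms(3) by (auto simp: Pi_iff)
  next
    fix i j assume ij: "i \<in> P" "j \<in> Q"
    have X: "X k i \<in> carrier R" if "k \<in> I" for k using a(3) ij that by (auto simp: Pi_iff)
    have Y: "Y k l \<in> carrier R" if "k \<in> I" "l \<in> L" for k l using a(4) that by (auto simp: Pi_iff)
    have b: "b l j \<in> carrier R" if "l \<in> L" for l using assms(3) ij that by (auto simp: Pi_iff)
    have "(\<Oplus>l\<in>L. a i l \<otimes> b l j) = (\<Oplus>l\<in>L. \<Oplus>k\<in>I. X k i \<otimes> Y k l \<otimes> b l j)"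
      using a(1,5) ij X Y b by (intro finsum_cong') (auto simp: finsum_ldistr)
    also have "\<dots> = (\<Oplus>k\<in>I. \<Oplus>l\<in>L. X k i \<otimes> Y k l \<otimes> b l j)"
      using a(1) assms(2) X Y b by (intro finsum_swap) auto
    also have "\<dots> = (\<Oplus>k\<in>I. X k i \<otimes> (\<Oplus>l\<in>L. Y k l \<otimes> b l j))"
      using assms(2) X Y b by (intro finsum_cong') (auto simp: finsum_rdistr m_assoc Pi_iff intro!: finsum_cong')
    finally show "(\<Oplus>l\<in>L. a i l \<otimes> b l j) = (\<Oplus>k\<in>I. X k i \<otimes> (\<Oplus>l\<in>L. Y k l \<otimes> b l j))" .
  qed
qed

lemma rank_le_mult_right:
  assumes "rank_le R L Q b r" "finite L" "a \<in> P \<rightarrow> L \<rightarrow> carrier R"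
  shows "rank_le R P Q (\<lambda>i j. \<Oplus>l\<in>L. a i l \<otimes> b l j) r"
proof -
  obtain I :: "nat set" and X Y where I: "X \<in> I \<rightarrow> L \<rightarrow> carrier R" "Y \<in> I \<rightarrow> Q \<rightarrow> carrier R"
    "\<forall>l\<in>L. \<forall>j\<in>Q. b l j = (\<Oplus>k\<in>I. X k l \<otimes> Y k j)"
    using assms(1) by (rule rank_leE)
  \<comment> \<open>Closure of the entries of \<open>b\<close> is read off from its factorization;
    transposition then reduces the claim to multiplication on the other side.\<close>
  have b: "b l j \<in> carrier R" if "l \<in> L" "j \<in> Q" for l j
  proof -
    have "b l j = (\<Oplus>k\<in>I. X k l \<otimes> Y k j)" using I(3) that by blast
    also have "\<dots> \<in> carrier R" using I(1,2) that by (intro finsum_closed) (auto simp: Pi_iff)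
    finally show ?thesis .
  qed
  have a: "a i l \<in> carrier R" if "i \<in> P" "l \<in> L" for i l
    using assms(3) that by (auto simp: Pi_iff)
  have "rank_le R Q P (\<lambda>j i. \<Oplus>l\<in>L. b l j \<otimes> a i l) r"
    by (rule rank_le_mult_left[OF rank_le_transpose[OF assms(1)] assms(2)]) (use a in blast)
  then have "rank_le R P Q (\<lambda>i j. \<Oplus>l\<in>L. b l j \<otimes> a i l) r"
    by (rule rank_le_transpose)
  then show ?thesis
  proof (rule rank_le_cong)
    fix i j assume ij: "i \<in> P" "j \<in> Q"
    show "(\<Oplus>l\<in>L. a i l \<otimes> b l j) = (\<Oplus>l\<in>L. b l j \<otimes> a i l)"
      using a[OF ij(1)] b[OF _ ij(2)] by (intro finsum_cong') (auto intro: m_comm)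
  qed
qed

text \<open>The identity matrix is the left factor and \<open>P\<close> itself the inner index set.
  This makes the \<open>LEAST\<close> in the later definition of the rank attained.\<close>

lemma rank_le_card:
  fixes P :: "nat set"
  assumes "finite P" "a \<in> P \<rightarrow> Q \<rightarrow> carrier R"
  shows "rank_le R P Q a (card P)"
proof (rule rank_leI[OF assms(1) order_refl _ assms(2), of "\<lambda>k i. if i = k then \<one> else \<zero>"])
  fix i j assume ij: "i \<in> P" "j \<in> Q"
  have "(\<Oplus>k\<in>P. (if i = k then \<one> else \<zero>) \<otimes> a k j) = (\<Oplus>k\<in>P. if i = k then a k j else \<zero>)"
    using assms ij by (intro finsum_cong') (auto simp: Pi_iff)
  also have "\<dots> = a i j"
    using assms ij by (intro finsum_singleton) (auto simp: Pi_iff)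
  finally show "a i j = (\<Oplus>k\<in>P. (if i = k then \<one> else \<zero>) \<otimes> a k j)" by simp
qed auto

end

lemma rank_le_0D: "rank_le R P Q a 0 \<Longrightarrow> abelian_monoid R \<Longrightarrow> i \<in> P \<Longrightarrow> j \<in> Q \<Longrightarrow> a i j = \<zero>\<^bsub>R\<^esub>"
  by (erule rank_leE) (simp add: abelian_monoid.finsum_empty)

text \<open>
  If the lower left block of \<open>a = \<Sum>\<^sub>k X\<^sub>k Y\<^sub>k\<close> vanishes and \<open>y = Y\<^sub>p(j\<^sub>0) \<noteq> 0\<close> for some
  column \<open>j\<^sub>0\<close> of the left half, then \<open>a' = a - a(\<cdot>, j\<^sub>0) y\<^sup>-\<^sup>1 Y\<^sub>p\<close> is a sum over the indices other
  than \<open>p\<close>. Since \<open>a(\<cdot>, j\<^sub>0)\<close> vanishes on the lower rows, \<open>a'\<close> has the same lower blocks as \<open>a\<close>,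
  while the rank of the upper left block has changed by at most one.
\<close>

lemma (in field) rank_le_blocks:
  fixes I :: "nat set"
  assumes "finite I" "X \<in> I \<rightarrow> P1 \<union> P2 \<rightarrow> carrier R" "Y \<in> I \<rightarrow> Q1 \<union> Q2 \<rightarrow> carrier R"
    and "\<And>i j. i \<in> P1 \<union> P2 \<Longrightarrow> j \<in> Q1 \<union> Q2 \<Longrightarrow> a i j = (\<Oplus>k\<in>I. X k i \<otimes> Y k j)"
    and "\<And>i j. i \<in> P2 \<Longrightarrow> j \<in> Q1 \<Longrightarrow> a i j = \<zero>"
  shows "\<exists>r s. r + s \<le> card I \<and> rank_le R P1 Q1 a r \<and> rank_le R P2 Q2 a s"
  using assms
\<comment> \<open>The correction below changes only the \<open>Y\<close> side, so \<open>X\<close>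
  stays fixed while \<open>Y\<close> and \<open>a\<close> vary.\<close>
proof (induction I arbitrary: Y a rule: finite_psubset_induct)
  case (psubset I)
  note X = psubset.prems(1) and Y = psubset.prems(2) and a = psubset.prems(3) and zero = psubset.prems(4)
  have Xc: "X k i \<in> carrier R" if "k \<in> I" "i \<in> P1 \<union> P2" for k i using X that by (auto simp: Pi_iff)
  have Yc: "Y k j \<in> carrier R" if "k \<in> I" "j \<in> Q1 \<union> Q2" for k j using Y that by (auto simp: Pi_iff)
  show ?case
  proof (cases "\<exists>p\<in>I. \<exists>j\<in>Q1. Y p j \<noteq> \<zero>")
    \<comment> \<open>All \<open>Y k\<close> vanish on the left columns, so the upper left block is
      zero and every term may be charged to the lower right block.\<close>
    case False
    have "a i j = \<zero>" if "i \<in> P1" "j \<in> Q1" for i j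
    proof -
      have "a i j = (\<Oplus>k\<in>I. X k i \<otimes> Y k j)"
        using that by (intro a) auto
      also have "\<dots> = \<zero>"
        using False that Xc by (intro add.finprod_one_eqI) auto
      finally show ?thesis .
    qed
    then have "rank_le R P1 Q1 a 0"
      by (intro rank_le_cong[OF rank_le_zero]) auto
    moreover have "rank_le R P2 Q2 a (card I)"
      using X Y a by (intro rank_leI[OF psubset.hyps order_refl, of X _ _ Y]) (auto simp: Pi_iff)
    ultimately show ?thesis
      by (intro exI[of _ 0] exI[of _ "card I"]) auto
  next
    case True
    then obtain p j0 where p: "p \<in> I" "j0 \<in> Q1" "Y p j0 \<noteq> \<zero>" by blast
    define y where "y = inv (Y p j0)"
    have y: "y \<in> carrier R" "Y p j0 \<otimes> y = \<one>"
      using p Yc field_Units unfolding y_def by auto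
    have ac: "a i j \<in> carrier R" if "i \<in> P1 \<union> P2" "j \<in> Q1 \<union> Q2" for i j
      unfolding a[OF that] by (rule finsum_closed) (use Xc Yc that in auto)
    \<comment> \<open>Each row \<open>Y k\<close> loses the multiple of \<open>Y p\<close> that
      clears its entry in column \<open>j0\<close>. For \<open>k = p\<close> this removes the whole
      row, which is why the index \<open>p\<close> drops out.\<close>
    define Y' where "Y' k j = Y k j \<oplus> \<ominus> (Y k j0 \<otimes> (y \<otimes> Y p j))" for k j
    define a' where "a' i j = a i j \<oplus> \<ominus> (a i j0 \<otimes> (y \<otimes> Y p j))" for i j
    have Y'c: "Y' k j \<in> carrier R" if "k \<in> I" "j \<in> Q1 \<union> Q2" for k j
      unfolding Y'_def using that Yc p y by auto
    have a': "a' i j = (\<Oplus>k\<in>I - {p}. X k i \<otimes> Y' k j)" if i: "i \<in> P1 \<union> P2" and j: "j \<in> Q1 \<union> Q2" for i j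
    proof -
      let ?c = "\<ominus> (y \<otimes> Y p j)"
      have c: "?c \<in> carrier R" using y p j Yc by auto
      have j0: "j0 \<in> Q1 \<union> Q2" using p by auto
      have "a' i j = a i j \<oplus> a i j0 \<otimes> ?c"
        unfolding a'_def using y p j Yc ac[OF i j0] by (simp add: r_minus)
      also have "\<dots> = (\<Oplus>k\<in>I. X k i \<otimes> Y k j) \<oplus> (\<Oplus>k\<in>I. X k i \<otimes> Y k j0 \<otimes> ?c)"
        unfolding a[OF i j] a[OF i j0] using psubset.hyps c Xc i Yc j0 by (subst finsum_ldistr) auto
      also have "\<dots> = (\<Oplus>k\<in>I. X k i \<otimes> Y k j \<oplus> X k i \<otimes> Y k j0 \<otimes> ?c)"
        using c Xc[OF _ i] Yc[OF _ j] Yc[OF _ j0] by (intro finsum_addf[symmetric]) auto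
      also have "\<dots> = (\<Oplus>k\<in>I. X k i \<otimes> Y' k j)"
        using Xc[OF _ i] Yc[OF _ j] Yc[OF _ j0] y Y'c p j
        by (intro finsum_cong') (auto simp: Y'_def r_distr r_minus m_assoc)
      also have "\<dots> = X p i \<otimes> Y' p j \<oplus> (\<Oplus>k\<in>I - {p}. X k i \<otimes> Y' k j)"
        using p psubset.hyps Xc[OF _ i] Y'c[OF _ j]
        by (subst insert_Diff[OF p(1), symmetric], subst finsum_insert) auto
      also have "Y' p j = \<zero>"
        unfolding Y'_def using y Yc[OF p(1) j0] Yc[OF p(1) j] by (simp add: m_assoc[symmetric] r_neg)
      finally show ?thesis
        using Xc[OF _ i] Y'c[OF _ j] p by simp
    qed
    have low: "a' i j = a i j" if "i \<in> P2" "j \<in> Q1 \<union> Q2" for i j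
      unfolding a'_def using zero[OF that(1) p(2)] ac[of i j] that y p Yc by simp
    have "\<exists>r s. r + s \<le> card (I - {p}) \<and> rank_le R P1 Q1 a' r \<and> rank_le R P2 Q2 a' s"
    proof (rule psubset.IH[of _ Y'])
      show "a' i j = \<zero>" if "i \<in> P2" "j \<in> Q1" for i j
        using low[of i j] zero[of i j] that by simp
    qed (use p X Y'c a' in \<open>auto simp: Pi_iff\<close>)
    then obtain r s where rs: "r + s \<le> card (I - {p})" "rank_le R P1 Q1 a' r" "rank_le R P2 Q2 a' s"
      by blast
    \<comment> \<open>Undoing the correction costs one outer product, paid for by the removed index
      \<open>p\<close>.\<close>
    have "rank_le R P1 Q1 (\<lambda>i j. a' i j \<oplus> a i j0 \<otimes> (y \<otimes> Y p j)) (r + 1)"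
      using ac y p Yc by (intro rank_le_add rs rank_le_outer) auto
    then have "rank_le R P1 Q1 a (r + 1)"
      by (rule rank_le_cong) (use ac y p Yc in \<open>simp add: a'_def a_assoc l_neg\<close>)
    moreover have "rank_le R P2 Q2 a s"
      using rs(3) by (rule rank_le_cong) (simp add: low)
    moreover have "r + 1 + s \<le> card I"
      using rs(1) card_Suc_Diff1[OF psubset.hyps p(1)] by linarith
    ultimately show ?thesis by blast
  qed
qed

section \<open>Matrix rank over a field is a Sylvester rank function\<close>

definition mat_rank :: "('a, 'm) ring_scheme \<Rightarrow> 'a mat \<Rightarrow> nat" where
  "mat_rank R A = (LEAST r. rank_le R {..<dim_row A} {..<dim_col A} (\<lambda>i j. A $$ (i, j)) r)"

context field
begin

lemma rank_le_mat_rank: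
  assumes "A \<in> mats R"
  shows "rank_le R {..<dim_row A} {..<dim_col A} (\<lambda>i j. A $$ (i, j)) (mat_rank R A)"
  unfolding mat_rank_def
  by (rule LeastI, rule rank_le_card) (auto intro: mats_entry[OF assms])

lemma mat_rank_le:
  "rank_le R {..<dim_row A} {..<dim_col A} (\<lambda>i j. A $$ (i, j)) r \<Longrightarrow> mat_rank R A \<le> r"
  unfolding mat_rank_def by (rule Least_le)

lemma mat_rank_elem:
  assumes "x \<in> carrier R"
  shows "mat_rank R (matrix_of_elem x) = (if x = \<zero> then 0 else 1)"
proof -
  let ?A = "matrix_of_elem x"
  have mem: "?A \<in> mats R"
    using assms by (intro matsI) (auto simp: matrix_of_elem_def)
  have "mat_rank R ?A \<le> 0" if "x = \<zero>"
    by (rule mat_rank_le, rule rank_le_cong[OF rank_le_zero]) (simp add: matrix_of_elem_def that)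
  moreover have "mat_rank R ?A \<noteq> 0" if "x \<noteq> \<zero>"
  proof
    assume "mat_rank R ?A = 0"
    with rank_le_mat_rank[OF mem] have "rank_le R {..<1} {..<1} (\<lambda>i j. ?A $$ (i, j)) 0"
      by (simp add: matrix_of_elem_def)
    from rank_le_0D[OF this abelian_monoid_axioms, of 0 0] that show False
      by (simp add: matrix_of_elem_def)
  qed
  moreover have "mat_rank R ?A \<le> card {..<dim_row ?A}"
    by (rule mat_rank_le, rule rank_le_card) (auto intro: mats_entry[OF mem])
  ultimately show ?thesis by (auto simp: matrix_of_elem_def)
qed

lemma mat_rank_prod:
  assumes A: "A \<in> mats R" and B: "B \<in> mats R" and dim: "dim_col A = dim_row B"
  shows "mat_rank R (mat_prod R A B) \<le> mat_rank R A" "mat_rank R (mat_prod R A B) \<le> mat_rank R B"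
proof -
  let ?M = "mat_prod R A B"
  let ?a = "\<lambda>i j. \<Oplus>k\<in>{..<dim_col A}. A $$ (i, k) \<otimes> B $$ (k, j)"
  have *: "mat_rank R ?M \<le> r" if "rank_le R {..<dim_row A} {..<dim_col B} ?a r" for r
  proof (rule mat_rank_le)
    have "rank_le R {..<dim_row A} {..<dim_col B} (\<lambda>i j. ?M $$ (i, j)) r"
      using that by (rule rank_le_cong) (simp add: mat_prod_def)
    then show "rank_le R {..<dim_row ?M} {..<dim_col ?M} (\<lambda>i j. ?M $$ (i, j)) r"
      by (simp add: mat_prod_def)
  qed
  show "mat_rank R ?M \<le> mat_rank R A"
    by (rule *, rule rank_le_mult_left[OF rank_le_mat_rank[OF A]]) (auto simp: dim intro: mats_entry[OF B])
  show "mat_rank R ?M \<le> mat_rank R B"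
    unfolding dim
    by (rule *[unfolded dim], rule rank_le_mult_right[OF rank_le_mat_rank[OF B]])
      (auto simp: dim intro: mats_entry[OF A])
qed

text \<open>An optimal factorization of the block matrix is split along its vanishing lower left
  block: its terms bound the sum of the two ranks found for the diagonal blocks.\<close>

lemma mat_rank_upper_block:
  assumes A: "A \<in> mats R" and B: "B \<in> mats R" and C: "C \<in> mats R"
    and dim: "dim_row C = dim_row A" "dim_col C = dim_col B"
  shows "mat_rank R A + mat_rank R B \<le> mat_rank R (upper_block R A C B)"
proof -
  let ?M = "upper_block R A C B"
  let ?P1 = "{..<dim_row A}" and ?Q1 = "{..<dim_col A}"
  let ?P2 = "{dim_row A..<dim_row A + dim_row B}" and ?Q2 = "{dim_col A..<dim_col A + dim_col B}"
  have M: "?M \<in> mats R"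
    using assms mats_entry[OF A] mats_entry[OF B] mats_entry[OF C]
    by (intro matsI) (auto simp: upper_block_def zero_matrix_def mats_def)
  have dims: "{..<dim_row ?M} = ?P1 \<union> ?P2" "{..<dim_col ?M} = ?Q1 \<union> ?Q2"
    by (auto simp: upper_block_def)
  obtain I :: "nat set" and X Y where I: "finite I" "card I \<le> mat_rank R ?M"
    "X \<in> I \<rightarrow> ?P1 \<union> ?P2 \<rightarrow> carrier R" "Y \<in> I \<rightarrow> ?Q1 \<union> ?Q2 \<rightarrow> carrier R"
    "\<forall>i\<in>?P1 \<union> ?P2. \<forall>j\<in>?Q1 \<union> ?Q2. ?M $$ (i, j) = (\<Oplus>k\<in>I. X k i \<otimes> Y k j)"
    using rank_le_mat_rank[OF M] unfolding dims by (rule rank_leE)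
  have "?M $$ (i, j) = \<zero>" if "i \<in> ?P2" "j \<in> ?Q1" for i j
    using that by (auto simp: upper_block_def zero_matrix_def less_diff_conv2)
  then obtain r s where rs: "r + s \<le> card I"
    "rank_le R ?P1 ?Q1 (\<lambda>i j. ?M $$ (i, j)) r" "rank_le R ?P2 ?Q2 (\<lambda>i j. ?M $$ (i, j)) s"
    using rank_le_blocks[OF I(1,3,4), of "\<lambda>i j. ?M $$ (i, j)"] I(5) by blast
  have "mat_rank R A \<le> r"
    by (rule mat_rank_le, rule rank_le_cong[OF rs(2)]) (simp add: upper_block_def)
  moreover have "mat_rank R B \<le> s"
  proof (rule mat_rank_le)
    \<comment> \<open>The guards are constantly true: only the index shift that moves the lower
      right block to the origin is wanted.\<close>
    have "rank_le R {..<dim_row B} {..<dim_col B}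
        (\<lambda>i j. if True \<and> True then ?M $$ (i + dim_row A, j + dim_col A) else \<zero>) s"
      by (rule rank_le_reindex[OF rs(3)]) auto
    then show "rank_le R {..<dim_row B} {..<dim_col B} (\<lambda>i j. B $$ (i, j)) s"
      by (rule rank_le_cong) (simp add: upper_block_def)
  qed
  ultimately show ?thesis using rs(1) I(2) by linarith
qed

text \<open>The block diagonal matrix is the sum of \<open>A\<close> and \<open>B\<close>, each
  padded by zeros. The guards in \<open>?b\<close> keep the truncated subtraction honest.\<close>

lemma mat_rank_block_diag_le:
  assumes A: "A \<in> mats R" and B: "B \<in> mats R"
  shows "mat_rank R (block_diag R A B) \<le> mat_rank R A + mat_rank R B"
proof (rule mat_rank_le, rule rank_le_cong)
  let ?M = "block_diag R A B"
  let ?a = "\<lambda>i j. if i < dim_row A \<and> j < dim_col A then A $$ (i, j) else \<zero>"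
  let ?b = "\<lambda>i j. if i \<ge> dim_row A \<and> j \<ge> dim_col A then B $$ (i - dim_row A, j - dim_col A) else \<zero>"
  show "rank_le R {..<dim_row ?M} {..<dim_col ?M} (\<lambda>i j. ?a i j \<oplus> ?b i j) (mat_rank R A + mat_rank R B)"
    by (intro rank_le_add rank_le_reindex[OF rank_le_mat_rank] A B)
      (auto simp: block_diag_def upper_block_def)
  fix i j assume "i \<in> {..<dim_row ?M}" "j \<in> {..<dim_col ?M}"
  then show "?M $$ (i, j) = ?a i j \<oplus> ?b i j"
    using mats_entry[OF A] mats_entry[OF B]
    by (auto simp: block_diag_def upper_block_def zero_matrix_def)
qed

theorem sylvester_rank_function_mat_rank: "sylvester_rank_function R (\<lambda>A. real (mat_rank R A))"
proof
  show "\<one> \<noteq> \<zero>" by simp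
  show "real (mat_rank R (matrix_of_elem \<one>)) = 1"
    by (simp add: mat_rank_elem)
next
  fix m n :: nat
  have "mat_rank R (zero_matrix R m n) \<le> 0"
    by (rule mat_rank_le, rule rank_le_cong[OF rank_le_zero]) (simp add: zero_matrix_def)
  then show "real (mat_rank R (zero_matrix R m n)) = 0" by simp
next
  fix A B assume AB: "A \<in> mats R" "B \<in> mats R"
  let ?Z = "zero_matrix R (dim_row A) (dim_col B)"
  have "?Z \<in> mats R"
    using AB by (intro matsI) (auto simp: zero_matrix_def mats_def)
  then have "mat_rank R A + mat_rank R B \<le> mat_rank R (block_diag R A B)"
    unfolding block_diag_def using AB by (intro mat_rank_upper_block) (auto simp: zero_matrix_def)
  then show "real (mat_rank R (block_diag R A B)) = real (mat_rank R A) + real (mat_rank R B)"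
    using mat_rank_block_diag_le[OF AB] by simp
next
  fix A B C assume "A \<in> mats R" "B \<in> mats R" "C \<in> mats R" "dim_row C = dim_row A" "dim_col C = dim_col B"
  then show "real (mat_rank R A) + real (mat_rank R B) \<le> real (mat_rank R (upper_block R A C B))"
    using mat_rank_upper_block[of A B C] by linarith
qed (auto simp: mat_rank_prod)

lemma von_neumann_regular_ring: "von_neumann_regular_ring R"
proof
  fix s assume s: "s \<in> carrier R"
  show "\<exists>t\<in>carrier R. s \<otimes> t \<otimes> s = s"
  proof (cases "s = \<zero>")
    case False
    then have "s \<in> Units R" using s field_Units by simp
    with s show ?thesis by (intro bexI[of _ "inv s"]) simp_all
  qed auto
qed simp

end

section \<open>Regular rank functions from homomorphisms into fields\<close>

text \<open>The field may live on any type, such as the type of cosets of an ideal;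
  \<open>regular_rank_functionI\<close> moves it to the list type demanded by the
  definition.\<close>

theorem regular_rank_function_of_hom:
  assumes "ring R" "field K" "\<phi> \<in> ring_hom R K"
  shows "(\<lambda>A. real (mat_rank K (map_mat \<phi> A))) \<in> regular_rank_functions R"
proof -
  note rk = field.sylvester_rank_function_mat_rank[OF assms(2)]
  show ?thesis
    by (rule regular_rank_functionI[OF sylvester_rank_function_pullback[OF assms(3,1) rk]
          field.von_neumann_regular_ring[OF assms(2)] assms(3) rk]) simp
qed

text \<open>Zorn's lemma for the ideals that contain \<open>a\<close> and omit 1. The principal
  ideal of \<open>a\<close> is one of them, since 1 being a multiple of \<open>a\<close> would make
  \<open>a\<close> a unit.\<close>

lemma (in cring) exists_maximalideal:
  assumes a: "a \<in> carrier R" "a \<notin> Units R"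
  obtains M where "maximalideal M R" "a \<in> M"
proof -
  define S where "S = {I. ideal I R \<and> a \<in> I \<and> \<one> \<notin> I}"
  have "\<one> \<notin> PIdl a"
    using a m_comm unfolding cgenideal_def Units_def by fastforce
  then have PIdl: "PIdl a \<in> S"
    using a cgenideal_ideal cgenideal_self by (simp add: S_def)
  have "\<exists>M\<in>S. \<forall>I\<in>S. M \<subseteq> I \<longrightarrow> I = M"
  proof (rule subset_Zorn)
    fix C assume C: "subset.chain S C"
    show "\<exists>U\<in>S. \<forall>I\<in>C. I \<subseteq> U"
    proof (cases "C = {}")
      \<comment> \<open>The empty chain also needs an upper bound, and its union is not an ideal
        containing \<open>a\<close>.\<close>
      case True
      then show ?thesis using PIdl by blast
    next
      case False
      have "subset.chain {I. ideal I R} C"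
        using C unfolding pred_on.chain_def S_def by auto
      from chain_Union_is_ideal[OF this] have "ideal (\<Union>C) R"
        using False by simp
      then have "\<Union>C \<in> S"
        using C False unfolding pred_on.chain_def S_def by auto
      then show ?thesis by blast
    qed
  qed
  then obtain M where M: "ideal M R" "a \<in> M" "\<one> \<notin> M" and max: "\<And>I. I \<in> S \<Longrightarrow> M \<subseteq> I \<Longrightarrow> I = M"
    unfolding S_def by blast
  have "maximalideal M R"
  proof (rule maximalidealI[OF M(1)])
    fix J assume J: "ideal J R" "M \<subseteq> J" "J \<subseteq> carrier R"
    show "J = M \<or> J = carrier R"
      using max[of J] J M(2) ideal.one_imp_carrier[OF J(1)] unfolding S_def by blast
  qed (use M(3) in auto)
  then show ?thesis using M(2) by (rule that)
qed

section \<open>Rings of functions of moderate growth\<close>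

text \<open>Only growth is restricted: the functions may be discontinuous. Both the constant and the
  exponent depend on the function, so that products stay inside.\<close>

definition moderate_ring :: "'x set \<Rightarrow> ('x \<Rightarrow> real) \<Rightarrow> ('x \<Rightarrow> complex) ring" where
  "moderate_ring X w = \<lparr>
     carrier = {a \<in> extensional X. \<exists>C m. \<forall>x\<in>X. cmod (a x) \<le> C * w x ^ m},
     mult = \<lambda>a b. \<lambda>x\<in>X. a x * b x,
     one = \<lambda>x\<in>X. 1,
     zero = \<lambda>x\<in>X. 0,
     add = \<lambda>a b. \<lambda>x\<in>X. a x + b x\<rparr>"

lemma moderate_ring_sel:
  "carrier (moderate_ring X w) = {a \<in> extensional X. \<exists>C m. \<forall>x\<in>X. cmod (a x) \<le> C * w x ^ m}"
  "a \<otimes>\<^bsub>moderate_ring X w\<^esub> b = (\<lambda>x\<in>X. a x * b x)"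
  "\<one>\<^bsub>moderate_ring X w\<^esub> = (\<lambda>x\<in>X. 1)"
  "\<zero>\<^bsub>moderate_ring X w\<^esub> = (\<lambda>x\<in>X. 0)"
  "a \<oplus>\<^bsub>moderate_ring X w\<^esub> b = (\<lambda>x\<in>X. a x + b x)"
  by (simp_all add: moderate_ring_def)

lemma moderate_ringI:
  assumes "\<And>x. x \<in> X \<Longrightarrow> cmod (a x) \<le> C * w x ^ m"
  shows "(\<lambda>x\<in>X. a x) \<in> carrier (moderate_ring X w)"
  unfolding moderate_ring_sel using assms by (auto intro!: exI[of _ C] exI[of _ m])

lemma moderate_ringE:
  assumes "a \<in> carrier (moderate_ring X w)"
  obtains C m where "\<forall>x\<in>X. cmod (a x) \<le> C * w x ^ m"
  using assms unfolding moderate_ring_sel by blast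

text \<open>A weight of at least 1 has increasing powers, so two bounds can be raised to the common
  exponent \<open>m + n\<close>. Absolute values spare a sign discussion for the constants.\<close>

lemma cring_moderate_ring:
  assumes w: "\<And>x. x \<in> X \<Longrightarrow> 1 \<le> w x"
  shows "cring (moderate_ring X w)"
proof (rule cringI)
  let ?R = "moderate_ring X w"
  have ext: "a \<in> extensional X" if "a \<in> carrier ?R" for a
    using that by (simp add: moderate_ring_sel)
  have eqI: "a = b" if "a \<in> extensional X" "b \<in> extensional X" "\<And>x. x \<in> X \<Longrightarrow> a x = b x"
    for a b :: "'a \<Rightarrow> complex"
    using that by (rule extensionalityI)
  show "abelian_group ?R"
  proof (rule abelian_groupI)
    fix a b assume a: "a \<in> carrier ?R" and b: "b \<in> carrier ?R"
    obtain C m where C: "\<forall>x\<in>X. cmod (a x) \<le> C * w x ^ m"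
      using a by (rule moderate_ringE)
    obtain D n where D: "\<forall>x\<in>X. cmod (b x) \<le> D * w x ^ n"
      using b by (rule moderate_ringE)
    show "a \<oplus>\<^bsub>?R\<^esub> b \<in> carrier ?R"
      unfolding moderate_ring_sel(5)
    proof (rule moderate_ringI)
      fix x assume x: "x \<in> X"
      have "C * w x ^ m \<le> \<bar>C\<bar> * w x ^ (m + n)"
        using w[OF x] by (intro mult_mono power_increasing) auto
      moreover have "D * w x ^ n \<le> \<bar>D\<bar> * w x ^ (m + n)"
        using w[OF x] by (intro mult_mono power_increasing) auto
      ultimately show "cmod (a x + b x) \<le> (\<bar>C\<bar> + \<bar>D\<bar>) * w x ^ (m + n)"
        using bspec[OF C x] bspec[OF D x] norm_triangle_ineq[of "a x" "b x"] by (simp add: distrib_right)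
    qed
  next
    show "\<zero>\<^bsub>?R\<^esub> \<in> carrier ?R"
      unfolding moderate_ring_sel(4) by (rule moderate_ringI[where C = 0 and m = 0]) simp
  next
    fix a assume a: "a \<in> carrier ?R"
    then obtain C m where "\<forall>x\<in>X. cmod (a x) \<le> C * w x ^ m"
      by (rule moderate_ringE)
    then have "(\<lambda>x\<in>X. - a x) \<in> carrier ?R"
      by (intro moderate_ringI) auto
    then show "\<exists>b\<in>carrier ?R. b \<oplus>\<^bsub>?R\<^esub> a = \<zero>\<^bsub>?R\<^esub>"
      by (rule bexI[rotated]) (auto simp: moderate_ring_sel intro!: eqI)
    show "\<zero>\<^bsub>?R\<^esub> \<oplus>\<^bsub>?R\<^esub> a = a"
      using ext[OF a] by (auto simp: moderate_ring_sel intro!: eqI)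
  qed (auto simp: moderate_ring_sel algebra_simps intro!: eqI)
  show "comm_monoid ?R"
  proof (rule comm_monoidI)
    fix a b assume a: "a \<in> carrier ?R" and b: "b \<in> carrier ?R"
    obtain C m where C: "\<forall>x\<in>X. cmod (a x) \<le> C * w x ^ m"
      using a by (rule moderate_ringE)
    obtain D n where D: "\<forall>x\<in>X. cmod (b x) \<le> D * w x ^ n"
      using b by (rule moderate_ringE)
    show "a \<otimes>\<^bsub>?R\<^esub> b \<in> carrier ?R"
      unfolding moderate_ring_sel(2)
    proof (rule moderate_ringI)
      fix x assume x: "x \<in> X"
      have "cmod (a x) * cmod (b x) \<le> (C * w x ^ m) * (D * w x ^ n)"
        using bspec[OF C x] bspec[OF D x] by (intro mult_mono) (auto intro: order_trans[OF norm_ge_zero])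
      then show "cmod (a x * b x) \<le> (C * D) * w x ^ (m + n)"
        by (simp add: norm_mult power_add mult_ac)
    qed
  next
    show "\<one>\<^bsub>?R\<^esub> \<in> carrier ?R"
      unfolding moderate_ring_sel(3) by (rule moderate_ringI[where C = 1 and m = 0]) simp
  next
    fix a assume a: "a \<in> carrier ?R"
    show "\<one>\<^bsub>?R\<^esub> \<otimes>\<^bsub>?R\<^esub> a = a"
      using ext[OF a] by (auto simp: moderate_ring_sel intro!: eqI)
  qed (auto simp: moderate_ring_sel algebra_simps intro!: eqI)
qed (auto simp: moderate_ring_sel algebra_simps)

text \<open>The summand 1 lifts the weight above 1 near x = 1, where ln(2/x) falls to ln 2 <
  1.\<close>

abbreviation log_ring :: "(real \<Rightarrow> complex) ring" where
  "log_ring \<equiv> moderate_ring {0<..1} (\<lambda>x. 1 + ln (2 / x))"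

lemma cring_log_ring: "cring log_ring"
  by (rule cring_moderate_ring) simp

lemma restrict_log_ring: "(\<lambda>h. \<lambda>x\<in>{0<..1}. h x) \<in> ring_hom C01 log_ring"
proof (rule ring_hom_memI)
  fix h assume h: "h \<in> carrier C01"
  show "(\<lambda>x\<in>{0<..1}. h x) \<in> carrier log_ring"
    by (rule moderate_ringI[where C = "alg_norm C01 h" and m = 0]) (auto intro: C01_norm_ge[OF h])
qed (auto simp: C01_sel moderate_ring_sel)

text \<open>An inverse would be 1/x, but x times any power of 1 + ln(2/x) tends to 0 as x decreases
  to 0.\<close>

lemma f_fun_not_unit: "(\<lambda>x\<in>{0<..1}. f_fun x) \<notin> Units log_ring"
proof
  assume "(\<lambda>x\<in>{0<..1}. f_fun x) \<in> Units log_ring"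
  then obtain b where b: "b \<in> carrier log_ring"
    and inv: "(\<lambda>x\<in>{0<..1}. b x * f_fun x) = (\<lambda>x\<in>{0<..1}. 1)"
    by (auto simp: Units_def moderate_ring_sel cong: restrict_cong)
  obtain C m where C: "\<forall>x\<in>{0<..1}. cmod (b x) \<le> C * (1 + ln (2 / x)) ^ m"
    using b by (rule moderate_ringE)
  have "1 \<le> C * (1 + ln (2 / x)) ^ m * x" if x: "x \<in> {0<..1}" for x
  proof -
    have "b x * f_fun x = 1" using fun_cong[OF inv, of x] x by simp
    then have "1 = cmod (b x) * x"
      using x by (auto simp: f_fun_def norm_mult dest!: arg_cong[of _ _ cmod])
    then show ?thesis using bspec[OF C x] x by (metis greaterThanAtMost_iff less_imp_le mult_right_mono)
  qed
  then have "\<forall>\<^sub>F x in at_right 0. 1 \<le> C * (1 + ln (2 / x)) ^ m * x"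
    by (auto simp: eventually_at_right_field intro!: exI[of _ 1])
  moreover have "((\<lambda>x. C * (1 + ln (2 / x)) ^ m * x) \<longlongrightarrow> 0) (at_right 0)"
    by real_asymp
  ultimately have "(1 :: real) \<le> 0"
    by (intro tendsto_lowerbound) auto
  then show False by simp
qed

lemma g_fun_unit: "(\<lambda>x\<in>{0<..1}. g_fun x) \<in> Units log_ring"
proof -
  interpret L: cring log_ring by (rule cring_log_ring)
  let ?b = "\<lambda>x\<in>{0<..1}. complex_of_real (ln (2 / x))"
  have b: "?b \<in> carrier log_ring"
    by (rule moderate_ringI[where C = 1 and m = 1]) auto
  have "(\<lambda>x\<in>{0<..1}. g_fun x) \<in> carrier log_ring"
    using ring_hom_closed[OF restrict_log_ring g_fun_C01] .
  moreover have "(\<lambda>x\<in>{0<..1}. g_fun x) \<otimes>\<^bsub>log_ring\<^esub> ?b = \<one>\<^bsub>log_ring\<^esub>"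
  proof -
    have "g_fun x * complex_of_real (ln (2 / x)) = 1" if "x \<in> {0<..1}" for x
    proof -
      have "0 < ln (2 / x)" using that by (intro ln_gt_zero) auto
      then show ?thesis using that by (simp add: g_fun_def)
    qed
    then show ?thesis by (auto simp: moderate_ring_sel)
  qed
  ultimately show ?thesis
    using b L.m_comm[OF b] unfolding Units_def by (metis (mono_tags, lifting) mem_Collect_eq)
qed

section \<open>Cuntz comparison of \<open>1 \<times> 1\<close> matrices\<close>

lemma (in ring) matrix_of_elem_mats: "a \<in> carrier R \<Longrightarrow> matrix_of_elem a \<in> mats R"
  by (intro matsI) (auto simp: matrix_of_elem_def)

lemma (in ring) mat_prod_elem:
  "a \<in> carrier R \<Longrightarrow> b \<in> carrier R
    \<Longrightarrow> mat_prod R (matrix_of_elem a) (matrix_of_elem b) = matrix_of_elem (a \<otimes> b)"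
  by (rule eq_matI) (auto simp: mat_prod_def matrix_of_elem_def lessThan_Suc)

lemma mat_diff_elem: "mat_diff R (matrix_of_elem a) (matrix_of_elem b) = matrix_of_elem (a \<ominus>\<^bsub>R\<^esub> b)"
  by (rule eq_matI) (auto simp: mat_diff_def matrix_of_elem_def)

context unital_cstar_algebra
begin

text \<open>The C*-identity turns the square root of the norm of
  \<open>star \<A> x \<otimes> x\<close> into the norm of \<open>x\<close>.\<close>

lemma column_norm_elem:
  assumes "x \<in> carrier \<A>"
  shows "column_norm \<A> (matrix_of_elem x) = alg_norm \<A> x"
proof -
  have "adjoint_mat \<A> (matrix_of_elem x) = matrix_of_elem (star \<A> x)"
    by (rule eq_matI) (auto simp: adjoint_mat_def matrix_of_elem_def)
  then have "mat_prod \<A> (adjoint_mat \<A> (matrix_of_elem x)) (matrix_of_elem x) = matrix_of_elem (star \<A> x \<otimes> x)"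
    using assms star_closed by (simp add: mat_prod_elem)
  then show ?thesis
    using assms by (simp add: column_norm_def matrix_of_elem_def cstar_identity norm_nonneg)
qed

text \<open>These are the two bounds for squeezing matrix norms to 0. The upper one is
  submultiplicativity on the unit ball; the column \<open>\<zero>\<close> shows that the set under
  the supremum is nonempty and contains 0.\<close>

lemma mat_norm_elem:
  assumes a: "a \<in> carrier \<A>"
  shows "0 \<le> mat_norm \<A> (matrix_of_elem a)" "mat_norm \<A> (matrix_of_elem a) \<le> alg_norm \<A> a"
proof -
  let ?S = "{column_norm \<A> (mat_prod \<A> (matrix_of_elem a) X) |X.
     X \<in> mats \<A> \<and> dim_row X = dim_col (matrix_of_elem a) \<and> dim_col X = 1 \<and> column_norm \<A> X \<le> 1}"
  have S: "?S = {alg_norm \<A> (a \<otimes> x) |x. x \<in> carrier \<A> \<and> alg_norm \<A> x \<le> 1}"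
  proof (intro equalityI subsetI)
    fix s assume "s \<in> ?S"
    then obtain X where X: "s = column_norm \<A> (mat_prod \<A> (matrix_of_elem a) X)" "X \<in> mats \<A>"
      "dim_row X = 1" "dim_col X = 1" "column_norm \<A> X \<le> 1"
      by (auto simp: matrix_of_elem_def)
    define x where "x = X $$ (0, 0)"
    have "X = matrix_of_elem x" "x \<in> carrier \<A>"
      using X mats_entry[OF X(2), of 0 0] by (auto simp: x_def matrix_of_elem_def)
    then show "s \<in> {alg_norm \<A> (a \<otimes> x) |x. x \<in> carrier \<A> \<and> alg_norm \<A> x \<le> 1}"
      using X a by (auto simp: mat_prod_elem column_norm_elem)
  next
    fix s assume "s \<in> {alg_norm \<A> (a \<otimes> x) |x. x \<in> carrier \<A> \<and> alg_norm \<A> x \<le> 1}"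
    then obtain x where "s = alg_norm \<A> (a \<otimes> x)" "x \<in> carrier \<A>" "alg_norm \<A> x \<le> 1"
      by auto
    then show "s \<in> ?S"
      using a by (intro CollectI exI[of _ "matrix_of_elem x"])
        (auto simp: mat_prod_elem column_norm_elem matrix_of_elem_mats, auto simp: matrix_of_elem_def)
  qed
  have le: "alg_norm \<A> (a \<otimes> x) \<le> alg_norm \<A> a" if "x \<in> carrier \<A>" "alg_norm \<A> x \<le> 1" for x
    using norm_mult[OF a that(1)] mult_left_mono[OF that(2) norm_nonneg[OF a]] by simp
  have zero: "\<zero> \<in> carrier \<A>" "alg_norm \<A> \<zero> = 0"
    by (simp_all add: norm_eq_zero)
  show "mat_norm \<A> (matrix_of_elem a) \<le> alg_norm \<A> a"
    unfolding mat_norm_def S using le zero by (intro cSup_least) force+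
  show "0 \<le> mat_norm \<A> (matrix_of_elem a)"
    unfolding mat_norm_def S
  proof (rule cSup_upper)
    show "0 \<in> {alg_norm \<A> (a \<otimes> x) |x. x \<in> carrier \<A> \<and> alg_norm \<A> x \<le> 1}"
      using a zero by (intro CollectI exI[of _ \<zero>]) simp
    show "bdd_above {alg_norm \<A> (a \<otimes> x) |x. x \<in> carrier \<A> \<and> alg_norm \<A> x \<le> 1}"
      using le by (intro bdd_aboveI[of _ "alg_norm \<A> a"]) auto
  qed
qed

lemma cuntz_le_elemI:
  assumes a: "a \<in> carrier \<A>" and b: "b \<in> carrier \<A>"
    and c: "\<And>n. c n \<in> carrier \<A>" and lim: "(\<lambda>n. alg_norm \<A> (c n \<otimes> b \<ominus> a)) \<longlonglongrightarrow> 0"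
  shows "cuntz_le \<A> (matrix_of_elem a) (matrix_of_elem b)"
  unfolding cuntz_le_def
proof (rule exI[of _ "\<lambda>n. matrix_of_elem (c n)"], rule exI[of _ "\<lambda>_. matrix_of_elem \<one>"], intro conjI allI)
  have eq: "mat_diff \<A> (mat_prod \<A> (mat_prod \<A> (matrix_of_elem (c n)) (matrix_of_elem b)) (matrix_of_elem \<one>))
      (matrix_of_elem a) = matrix_of_elem (c n \<otimes> b \<ominus> a)" for n
    using b c by (simp add: mat_prod_elem mat_diff_elem)
  show "(\<lambda>n. mat_norm \<A> (mat_diff \<A> (mat_prod \<A> (mat_prod \<A> (matrix_of_elem (c n)) (matrix_of_elem b))
      (matrix_of_elem \<one>)) (matrix_of_elem a))) \<longlonglongrightarrow> 0"
    unfolding eq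
    by (rule tendsto_sandwich[OF _ _ tendsto_const lim]) (auto simp: mat_norm_elem a b c)
qed (auto simp: matrix_of_elem_mats c, auto simp: matrix_of_elem_def)

end

lemma cuntz_le_g_fun_f_fun: "cuntz_le C01 (matrix_of_elem g_fun) (matrix_of_elem f_fun)"
proof -
  interpret unital_cstar_algebra C01 by (rule unital_cstar_algebra_C01)
  \<comment> \<open>Ideally the multiplier would be g/f, which is unbounded at 0; cutting the
    denominator off at 1/(n + 1) makes it continuous.\<close>
  define c where "c n = (\<lambda>x\<in>{0..1}. g_fun x / complex_of_real (max x (1 / real (Suc n))))" for n
  have c: "c n \<in> carrier C01" for n
  proof -
    have "max x (1 / real (Suc n)) \<noteq> 0" for x
      using less_max_iff_disj[of 0 x "1 / real (Suc n)"] by auto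
    then show ?thesis
      unfolding c_def by (intro C01_I continuous_intros C01_D g_fun_C01) auto
  qed
  have diff: "c n \<otimes>\<^bsub>C01\<^esub> f_fun \<ominus>\<^bsub>C01\<^esub> g_fun \<in> carrier C01" for n
    using c f_fun_C01 g_fun_C01 by auto
  \<comment> \<open>The error lives on 0 < x < 1/(n + 1). There it is at most g(x), and g is
    increasing, so its value 1 / ln(2 (n + 1)) at the cut-off bounds it.\<close>
  have bound: "alg_norm C01 (c n \<otimes>\<^bsub>C01\<^esub> f_fun \<ominus>\<^bsub>C01\<^esub> g_fun) \<le> 1 / ln (2 * real (Suc n))" for n
    unfolding C01_norm_le_iff[OF diff]
  proof
    fix x :: real assume x: "x \<in> {0..1}"
    define e where "e = 1 / real (Suc n)"
    have e: "0 < e" by (simp add: e_def)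
    have val: "(c n \<otimes>\<^bsub>C01\<^esub> f_fun \<ominus>\<^bsub>C01\<^esub> g_fun) x = g_fun x * of_real (x / max x e - 1)"
    proof -
      have "(c n \<otimes>\<^bsub>C01\<^esub> f_fun \<ominus>\<^bsub>C01\<^esub> g_fun) x = c n x * f_fun x - g_fun x"
        using x unfolding C01_minus[OF m_closed[OF c f_fun_C01] g_fun_C01] by (simp add: C01_sel(2))
      also have "\<dots> = g_fun x * of_real (x / max x e - 1)"
        using x by (simp add: c_def f_fun_def e_def right_diff_distrib)
      finally show ?thesis .
    qed
    show "cmod ((c n \<otimes>\<^bsub>C01\<^esub> f_fun \<ominus>\<^bsub>C01\<^esub> g_fun) x) \<le> 1 / ln (2 * real (Suc n))"
    proof (cases "0 < x \<and> x < e")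
      case True
      have pos: "0 < ln (2 * real (Suc n))" by (rule ln_gt_zero) simp
      have "\<bar>x / max x e - 1\<bar> \<le> 1"
        using True by (simp add: abs_le_iff field_simps)
      moreover have "2 * real (Suc n) \<le> 2 / x"
        using True by (simp add: e_def field_simps)
      then have "ln (2 * real (Suc n)) \<le> ln (2 / x)"
        using True by simp
      then have "cmod (g_fun x) \<le> 1 / ln (2 * real (Suc n))"
        using True x pos by (simp add: g_fun_def norm_divide frac_le)
      ultimately have "cmod (g_fun x) * \<bar>x / max x e - 1\<bar> \<le> 1 / ln (2 * real (Suc n)) * 1"
        using pos by (intro mult_mono) auto
      then show ?thesis
        unfolding val Real_Vector_Spaces.norm_mult norm_of_real mult_1_right .
    next
      case False
      \<comment> \<open>Either x = 0, where g vanishes, or x is at least \<open>e\<close>, where the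
        cut-off is inactive and the second factor vanishes.\<close>
      then have zero: "g_fun x * of_real (x / max x e - 1) = 0"
        using x e by (auto simp: g_fun_def max_def)
      show ?thesis unfolding val zero by (simp add: ln_ge_zero)
    qed
  qed
  have lim: "(\<lambda>n. 1 / ln (2 * real (Suc n))) \<longlonglongrightarrow> 0"
    by real_asymp
  have "(\<lambda>n. alg_norm C01 (c n \<otimes>\<^bsub>C01\<^esub> f_fun \<ominus>\<^bsub>C01\<^esub> g_fun)) \<longlonglongrightarrow> 0"
    by (rule tendsto_sandwich[OF always_eventually always_eventually tendsto_const lim])
      (use norm_nonneg diff bound in blast)+
  then show ?thesis
    by (rule cuntz_le_elemI[OF g_fun_C01 f_fun_C01 c])
qed

section \<open>The rank function\<close>

theorem mainTheorem11:
  shows "\<exists>rk \<in> regular_rank_functions C01.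
    rk (matrix_of_elem g_fun) = 1 \<and> rk (matrix_of_elem f_fun) = 0 \<and>
    \<not> dimension_function C01 rk"
proof -
  interpret L: cring log_ring by (rule cring_log_ring)
  interpret C01: cring C01 by (rule cring_C01)
  define \<rho> where "\<rho> h = (\<lambda>x\<in>{0<..1}. h x)" for h :: "real \<Rightarrow> complex"
  have \<rho>: "\<rho> \<in> ring_hom C01 log_ring"
    using restrict_log_ring by (simp add: \<rho>_def[abs_def])
  obtain M where M: "maximalideal M log_ring" "\<rho> f_fun \<in> M"
    using L.exists_maximalideal[of "\<rho> f_fun"] ring_hom_closed[OF \<rho> f_fun_C01] f_fun_not_unit
    unfolding \<rho>_def by blast
  interpret M: maximalideal M log_ring by (rule M(1))
  define K where "K = log_ring Quot M"
  interpret K: field K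
    unfolding K_def by (rule M.quotient_is_field[OF cring_log_ring])
  define \<phi> where "\<phi> h = M +>\<^bsub>log_ring\<^esub> \<rho> h" for h
  have \<pi>: "(+>\<^bsub>log_ring\<^esub>) M \<in> ring_hom log_ring K"
    unfolding K_def by (rule M.rcos_ring_hom)
  then have \<phi>: "\<phi> \<in> ring_hom C01 K"
    using ring_hom_trans[OF \<rho>] by (simp add: \<phi>_def[abs_def] o_def)
  define rk where "rk A = real (mat_rank K (map_mat \<phi> A))" for A
  have reg: "rk \<in> regular_rank_functions C01"
    using regular_rank_function_of_hom[OF C01.ring_axioms K.field_axioms \<phi>] by (simp add: rk_def[abs_def])
  have elem: "rk (matrix_of_elem h) = (if \<phi> h = \<zero>\<^bsub>K\<^esub> then 0 else 1)" if "h \<in> carrier C01" for h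
  proof -
    have "map_mat \<phi> (matrix_of_elem h) = matrix_of_elem (\<phi> h)"
      by (rule eq_matI) (auto simp: matrix_of_elem_def)
    then show ?thesis
      using K.mat_rank_elem[OF ring_hom_closed[OF \<phi> that]] by (simp add: rk_def)
  qed
  \<comment> \<open>The coset of an element of \<open>M\<close> is \<open>M\<close> itself, the zero
    of the quotient.\<close>
  have f: "rk (matrix_of_elem f_fun) = 0"
    using M(2) by (simp add: elem f_fun_C01 \<phi>_def K_def FactRing_def M.a_rcos_const)
  have "\<rho> g_fun \<in> Units log_ring"
    using g_fun_unit by (simp add: \<rho>_def)
  then obtain b where b: "b \<in> carrier log_ring" "b \<otimes>\<^bsub>log_ring\<^esub> \<rho> g_fun = \<one>\<^bsub>log_ring\<^esub>"
    unfolding Units_def by blast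
  have "(M +>\<^bsub>log_ring\<^esub> b) \<otimes>\<^bsub>K\<^esub> \<phi> g_fun = \<one>\<^bsub>K\<^esub>"
    unfolding \<phi>_def
    using ring_hom_mult[OF \<pi> b(1) ring_hom_closed[OF \<rho> g_fun_C01]] ring_hom_one[OF \<pi>] b(2) by simp
  \<comment> \<open>A unit stays a unit under the quotient map, and zero is no unit in a
    field.\<close>
  then have "\<phi> g_fun \<noteq> \<zero>\<^bsub>K\<^esub>"
    using ring_hom_closed[OF \<pi> b(1)] by auto
  then have g: "rk (matrix_of_elem g_fun) = 1"
    by (simp add: elem g_fun_C01)
  have "\<not> dimension_function C01 rk"
  proof
    assume "dimension_function C01 rk"
    then have "rk (matrix_of_elem g_fun) \<le> rk (matrix_of_elem f_fun)"
      unfolding dimension_function_def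
      using cuntz_le_g_fun_f_fun C01.matrix_of_elem_mats[OF f_fun_C01] C01.matrix_of_elem_mats[OF g_fun_C01]
      by blast
    then show False using f g by simp
  qed
  with reg f g show ?thesis by blast
qed

end
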